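(* Let $n\ge 1$ and let $w\in S_n$. Then $x^{\delta_n}\mathfrak{S}_w(x^{-1}) = x_1^{n-1}x_2^{n-2}\cdots x_{n-1}^{1}\,\mathfrak{S}_w(x_1^{-1},\ldots,x_n^{-1})$ is a Schubert polynomial if and only if $w$ avoids the patterns $132$ and $312$.
   Context: $S_n$ is the symmetric group of permutations $w=w_1w_2\cdots w_n$ of $[n]=\{1,\ldots,n\}$, and $s_i$ is the adjacent transposition of $i$ and $i+1$; $ws_i$ is obtained from $w$ by swapping $w_i$ and $w_{i+1}$. For a polynomial $f$, the divided difference is $\partial_i f=(f-s_if)/(x_i-x_{i+1})$, where $s_if$ swaps $x_i$ and $x_{i+1}$. Schubert polynomials: for $w_0=n\cdots 21$, $\mathfrak{S}_{w_0}(x)=x_1^{n-1}x_2^{n-2}\cdots x_{n-1}$, and for $w\ne w_0$ choose $i$ with $w_i<w_{i+1}$ and set $\mathfrak{S}_w(x)=\partial_i\mathfrak{S}_{ws_i}(x)$ (well defined). Appending fixed points $n+1,\ldots,m$ to $w$ does not change $\mathfrak{S}_w$; "a Schubert polynomial" means $\mathfrak{S}_{u}(x)$ for some permutation $u$ (of some $[m]$). $\delta_n=(n-1,n-2,\ldots,1,0)$ and $x^\mu=x_1^{\mu_1}\cdots x_n^{\mu_n}$. A permutation $w$ avoids $132$ if there are no $i<j<k$ with $w_i<w_k<w_j$, and avoids $312$ if there are no $i<j<k$ with $w_j<w_k<w_i$. *)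

theory Defs
  imports Complex_Main "HOL-Library.Poly_Mapping" "HOL-Combinatorics.Permutations"
begin

text \<open>Integer polynomials and Laurent polynomials in variables indexed by \<open>nat\<close>: a finitely
  supported exponent vector (with entries in \<open>nat\<close>, respectively \<open>int\<close>) is sent to the coefficient
  of the corresponding monomial.  Multiplication is the convolution product of \<open>Poly_Mapping\<close>.
  The variable with index \<open>0\<close> is never used.\<close>

type_synonym poly_ring = "(nat \<Rightarrow>\<^sub>0 nat) \<Rightarrow>\<^sub>0 int"
type_synonym laurent_ring = "(nat \<Rightarrow>\<^sub>0 int) \<Rightarrow>\<^sub>0 int"

definition X :: "nat \<Rightarrow> poly_ring" where
  "X i = Poly_Mapping.single (Poly_Mapping.single i 1) 1"

definition LX :: "nat \<Rightarrow> laurent_ring" where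
  "LX i = Poly_Mapping.single (Poly_Mapping.single i 1) 1"

definition LX_inv :: "nat \<Rightarrow> laurent_ring" where
  "LX_inv i = Poly_Mapping.single (Poly_Mapping.single i (- 1)) 1"

lemma LX_mult_LX_inv: "LX i * LX_inv i = 1"
  by (simp add: LX_def LX_inv_def mult_single flip: single_add)

definition subst_poly :: "(nat \<Rightarrow> 'a::comm_ring_1) \<Rightarrow> poly_ring \<Rightarrow> 'a" where
  "subst_poly \<phi> f =
     (\<Sum>e\<in>Poly_Mapping.keys f. of_int (Poly_Mapping.lookup f e) *
        (\<Prod>i\<in>Poly_Mapping.keys e. \<phi> i ^ Poly_Mapping.lookup e i))"

text \<open>The quotient is written as the polynomial \<open>g\<close> with \<open>g * (X i - X (i + 1)) = f - s\<^sub>i f\<close>;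
  it is unique because \<open>poly_ring\<close> is an integral domain.\<close>

definition divided_difference :: "nat \<Rightarrow> poly_ring \<Rightarrow> poly_ring" where
  "divided_difference i f =
     (THE g. g * (X i - X (Suc i)) = f - subst_poly (\<lambda>j. X (transpose i (Suc i) j)) f)"

lemma X_neq: "i \<noteq> j \<Longrightarrow> X i \<noteq> X j"
proof
  assume "i \<noteq> j" and "X i = X j"
  then have "Poly_Mapping.keys (X i) = Poly_Mapping.keys (X j)" by simp
  then have "Poly_Mapping.single i (1::nat) = Poly_Mapping.single j 1" by (simp add: X_def)
  then have "Poly_Mapping.keys (Poly_Mapping.single i (1::nat)) =
    Poly_Mapping.keys (Poly_Mapping.single j (1::nat))" by simp
  with \<open>i \<noteq> j\<close> show False by simp
qed

lemma divided_difference_eqI: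
  assumes "g * (X i - X (Suc i)) = f - subst_poly (\<lambda>j. X (transpose i (Suc i) j)) f"
  shows "divided_difference i f = g"
  unfolding divided_difference_def
proof (rule the_equality)
  fix h assume "h * (X i - X (Suc i)) = f - subst_poly (\<lambda>j. X (transpose i (Suc i) j)) f"
  with assms have "h * (X i - X (Suc i)) = g * (X i - X (Suc i))" by simp
  moreover have "X i - X (Suc i) \<noteq> 0" using X_neq[of i "Suc i"] by simp
  ultimately show "h = g" by simp
qed (fact assms)

text \<open>An element \<open>w\<close> of $S_n$ is a function with \<open>w permutes {1..n}\<close>; it fixes everything outside
  \<open>{1..n}\<close>.\<close>

definition longest_perm :: "nat \<Rightarrow> nat \<Rightarrow> nat" where
  "longest_perm n i = (if i \<in> {1..n} then n + 1 - i else i)"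

lemma ascent_exists:
  assumes "w permutes {1..n}" and "w \<noteq> longest_perm n"
  shows "\<exists>i. 1 \<le> i \<and> i < n \<and> w i < w (Suc i)"
proof (rule ccontr)
  assume no: "\<nexists>i. 1 \<le> i \<and> i < n \<and> w i < w (Suc i)"
  have inj: "inj w" using assms(1) by (rule permutes_inj)
  have desc: "w (Suc i) < w i" if "1 \<le> i" "i < n" for i
    using no that inj_eq[OF inj, of i "Suc i"] by (metis less_irrefl_nat linorder_neqE_nat n_not_Suc_n)
  have range: "1 \<le> w i \<and> w i \<le> n" if "1 \<le> i" "i \<le> n" for i
    using permutes_in_image[OF assms(1), of i] that by auto
  have up: "w (Suc k) + Suc k \<le> n + 1" if "Suc k \<le> n" for k
    using that
  proof (induction k)
    case 0
    then show ?case using range[of 1] by simp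
  next
    case (Suc k)
    then show ?case using desc[of "Suc k"] by simp
  qed
  have lo: "k + 1 \<le> w (n - k)" if "k < n" for k
    using that
  proof (induction k)
    case 0
    then show ?case using range[of n] by simp
  next
    case (Suc k)
    moreover have "Suc (n - Suc k) = n - k" using Suc.prems by simp
    moreover have "1 \<le> n - Suc k" "n - Suc k < n" using Suc.prems by linarith+
    ultimately show ?case using desc[of "n - Suc k"] by simp
  qed
  have "w i = longest_perm n i" for i
  proof (cases "i \<in> {1..n}")
    case True
    then show ?thesis using up[of "i - 1"] lo[of "n - i"] by (auto simp: longest_perm_def)
  next
    case False
    then show ?thesis using permutes_not_in[OF assms(1) False] by (auto simp: longest_perm_def)
  qed
  with assms(2) show False by blast
qed

definition noninversions :: "nat \<Rightarrow> (nat \<Rightarrow> nat) \<Rightarrow> (nat \<times> nat) set" where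
  "noninversions n w = {(a, b). 1 \<le> a \<and> a < b \<and> b \<le> n \<and> w a < w b}"

lemma card_noninversions_decreases:
  assumes i: "1 \<le> i" "i < n" and asc: "w i < w (Suc i)"
  shows "card (noninversions n (w \<circ> transpose i (Suc i))) < card (noninversions n w)"
proof -
  let ?t = "transpose i (Suc i)"
  have fin: "finite (noninversions n v)" for v
    by (rule finite_subset[of _ "{1..n} \<times> {1..n}"]) (auto simp: noninversions_def)
  have "inj_on (map_prod ?t ?t) (noninversions n (w \<circ> ?t))"
    by (rule inj_on_subset[of _ UNIV]) (auto intro!: prod.inj_map)
  moreover have "map_prod ?t ?t ` noninversions n (w \<circ> ?t) \<subseteq> noninversions n w - {(i, Suc i)}"
    using i asc by (auto simp: noninversions_def transpose_def split: if_splits)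
  ultimately have "card (noninversions n (w \<circ> ?t)) \<le> card (noninversions n w - {(i, Suc i)})"
    using fin by (meson card_inj_on_le finite_Diff)
  also have "\<dots> < card (noninversions n w)"
    by (rule card_Diff1_less[OF fin]) (use i asc in \<open>auto simp: noninversions_def\<close>)
  finally show ?thesis .
qed

text \<open>The ascent used in the recursion is an arbitrary one, picked by Hilbert choice; the result is
  classically known not to depend on the choice.  The guard \<open>w permutes {1..n}\<close> only serves to make
  the function total: arguments violating it are meaningless.\<close>

function schubert :: "nat \<Rightarrow> (nat \<Rightarrow> nat) \<Rightarrow> poly_ring" where
  "schubert n w =
     (if w permutes {1..n} \<and> w \<noteq> longest_perm n
      then let i = (SOME i. 1 \<le> i \<and> i < n \<and> w i < w (Suc i))
           in divided_difference i (schubert n (w \<circ> transpose i (Suc i)))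
      else (\<Prod>i\<in>{1..n}. X i ^ (n - i)))"
  by pat_completeness auto
termination
proof (relation "measure (\<lambda>(n, w). card (noninversions n w))")
  fix n w i
  assume "w permutes {1..n} \<and> w \<noteq> longest_perm n"
    and "i = (SOME i. 1 \<le> i \<and> i < n \<and> w i < w (Suc i))"
  then have "1 \<le> i \<and> i < n \<and> w i < w (Suc i)"
    using someI_ex[OF ascent_exists[of w n]] by auto
  then show "((n, w \<circ> transpose i (Suc i)), n, w) \<in> measure (\<lambda>(n, w). card (noninversions n w))"
    using card_noninversions_decreases by simp
qed simp

declare schubert.simps [simp del]

text \<open>A Schubert polynomial, regarded as a Laurent polynomial via \<open>X i \<mapsto> LX i\<close>.\<close>

definition is_schubert_polynomial :: "laurent_ring \<Rightarrow> bool" where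
  "is_schubert_polynomial g \<longleftrightarrow>
     (\<exists>m u. u permutes {1..m} \<and> g = subst_poly LX (schubert m u))"

definition avoids_132 :: "nat \<Rightarrow> (nat \<Rightarrow> nat) \<Rightarrow> bool" where
  "avoids_132 n w \<longleftrightarrow>
     \<not> (\<exists>i j k. 1 \<le> i \<and> i < j \<and> j < k \<and> k \<le> n \<and> w i < w k \<and> w k < w j)"

definition avoids_312 :: "nat \<Rightarrow> (nat \<Rightarrow> nat) \<Rightarrow> bool" where
  "avoids_312 n w \<longleftrightarrow>
     \<not> (\<exists>i j k. 1 \<le> i \<and> i < j \<and> j < k \<and> k \<le> n \<and> w j < w k \<and> w k < w i)"

end

theory Submission
  imports Defs "HOL-Computational_Algebra.Polynomial"
begin

text \<open>Write $f^*(x) = x^{\delta_n} f(x^{-1})$ and suppose $\mathfrak{S}_w^* = \mathfrak{S}_u$.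
  If $w_i < w_{i+1}$, then $\mathfrak{S}_w$ is symmetric in $x_i, x_{i+1}$, which means
  $\mathfrak{S}_u = x_i \mathfrak{S}_{u s_i}$.  By Monk's rule and the linear independence of Schubert
  polynomials this holds iff $u$ has a \<^emph>\<open>good descent\<close> at $i$: $u_{i+1}$ is smaller than $u_i$ and
  all earlier entries, and no later value lies between $u_{i+1}$ and $u_i$.  The relation is symmetric
  in $w$ and $u$.  At a position $i$ where $w$ has a descent which is not good, $u$ also has one, and
  $x_i \partial_i \mathfrak{S}_u = (\mathfrak{S}_w - x_i \partial_i \mathfrak{S}_w)^*$; evaluating at
  $x = (1, 1, \dots)$, where Schubert polynomials are positive, Monk's rule gives an entry
  $w_j < w_{i+1}$ with $j < i$, and likewise for $u$.  For the first such $i$ this is impossible, because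
  position $i - 1$ is a good descent of $w$ or of $u$.  Hence every descent of $w$ is good, which
  excludes both patterns.  Conversely, if $w$ avoids both patterns, then $w$ and $w_0 w$ are dominant,
  their Schubert polynomials are the monomials of their Lehmer codes, and these codes add up to
  $\delta_n$.\<close>

subsection \<open>Ring homomorphisms on polynomials\<close>

text \<open>Schubert polynomials are accessible here only through their divided differences, so
  Monk's rule and the derivative formula \<open>nabla_sch\<close> rest on one principle: a
  polynomial free of \<open>X 0\<close> is determined by its constant term and by all its divided
  differences of positive index. This needs infinitely many variables, since a polynomial symmetric
  in finitely many variables need not be constant; and the partner \<open>u\<close> may lie in a
  larger symmetric group than \<open>w\<close>. Hence \<open>sch\<close>, which carries no
  \<open>n\<close>. Positivity is needed at a single point only. Instead of a monomial expansion,
  the proof uses that \<open>nabla\<close> commutes with divided differences and expands with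
  positive integer weights in shorter Schubert polynomials, and that a univariate polynomial has
  nonnegative coefficients as soon as its constant term and its derivative do.\<close>

definition lin_ext :: "('a \<Rightarrow> 'r::comm_ring_1) \<Rightarrow> ('a \<Rightarrow>\<^sub>0 int) \<Rightarrow> 'r" where
  "lin_ext F f = (\<Sum>e\<in>Poly_Mapping.keys f. of_int (Poly_Mapping.lookup f e) * F e)"

lemma lin_ext_superset:
  assumes "finite A" "Poly_Mapping.keys f \<subseteq> A"
  shows "lin_ext F f = (\<Sum>e\<in>A. of_int (Poly_Mapping.lookup f e) * F e)"
  unfolding lin_ext_def
  by (rule sum.mono_neutral_left) (use assms in \<open>auto simp: in_keys_iff\<close>)

lemma lin_ext_add: "lin_ext F (f + g) = lin_ext F f + lin_ext F g"
proof -
  let ?A = "Poly_Mapping.keys f \<union> Poly_Mapping.keys g"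
  have "Poly_Mapping.keys (f + g) \<subseteq> ?A" by (rule keys_add)
  then show ?thesis
    by (simp add: lin_ext_superset[of ?A] lookup_add ring_distribs sum.distrib)
qed

lemma lin_ext_single [simp]: "lin_ext F (Poly_Mapping.single e c) = of_int c * F e"
  by (simp add: lin_ext_def)

lemma lin_ext_zero [simp]: "lin_ext F 0 = 0"
  by (simp add: lin_ext_def)

lemma poly_mapping_add_single_induct [case_names zero add]:
  fixes f :: "'a \<Rightarrow>\<^sub>0 'b::ab_group_add"
  assumes "P 0" and add: "\<And>f e c. P f \<Longrightarrow> P (f + Poly_Mapping.single e c)"
  shows "P f"
proof (induction "card (Poly_Mapping.keys f)" arbitrary: f)
  case 0
  then show ?case using assms(1) by simp
next
  case (Suc n)
  then obtain e where e: "e \<in> Poly_Mapping.keys f" by fastforce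
  let ?g = "f - Poly_Mapping.single e (Poly_Mapping.lookup f e)"
  have "Poly_Mapping.keys ?g = Poly_Mapping.keys f - {e}"
    by (auto simp: in_keys_iff lookup_minus lookup_single when_def split: if_splits)
  then have "card (Poly_Mapping.keys ?g) = n" using Suc e by simp
  then have "P (?g + Poly_Mapping.single e (Poly_Mapping.lookup f e))"
    using Suc.hyps(1)[of ?g] add by blast
  then show ?case by simp
qed

definition ring_hom :: "('a::comm_ring_1 \<Rightarrow> 'b::comm_ring_1) \<Rightarrow> bool" where
  "ring_hom h \<longleftrightarrow> h 1 = 1 \<and> (\<forall>a b. h (a + b) = h a + h b) \<and> (\<forall>a b. h (a * b) = h a * h b)"

lemma ring_homI:
  assumes "h 1 = 1" "\<And>a b. h (a + b) = h a + h b" "\<And>a b. h (a * b) = h a * h b"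
  shows "ring_hom h"
  using assms by (simp add: ring_hom_def)

context
  fixes h :: "'a::comm_ring_1 \<Rightarrow> 'b::comm_ring_1"
  assumes h: "ring_hom h"
begin

lemma ring_hom_one: "h 1 = 1"
  and ring_hom_add: "h (a + b) = h a + h b"
  and ring_hom_mult: "h (a * b) = h a * h b"
  using h by (auto simp: ring_hom_def)

lemma ring_hom_zero: "h 0 = 0"
  using ring_hom_add[of 0 0] by simp

lemma ring_hom_uminus: "h (- a) = - h a"
  using ring_hom_add[of a "- a"] by (simp add: ring_hom_zero add_eq_0_iff)

lemma ring_hom_diff: "h (a - b) = h a - h b"
  using ring_hom_add[of a "- b"] by (simp add: ring_hom_uminus)

lemma ring_hom_sum: "h (sum f A) = (\<Sum>i\<in>A. h (f i))"
  by (induction A rule: infinite_finite_induct) (auto simp: ring_hom_zero ring_hom_add)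

lemma ring_hom_prod: "h (prod f A) = (\<Prod>i\<in>A. h (f i))"
  by (induction A rule: infinite_finite_induct) (auto simp: ring_hom_one ring_hom_mult)

lemma ring_hom_power: "h (a ^ k) = h a ^ k"
  by (induction k) (auto simp: ring_hom_one ring_hom_mult)

lemma ring_hom_of_nat: "h (of_nat k) = of_nat k"
  by (induction k) (auto simp: ring_hom_one ring_hom_add ring_hom_zero)

lemma ring_hom_of_int: "h (of_int k) = of_int k"
  by (cases k) (auto simp: ring_hom_of_nat ring_hom_uminus ring_hom_diff ring_hom_one)

lemmas ring_hom_simps = ring_hom_one ring_hom_zero ring_hom_add ring_hom_diff ring_hom_uminus
  ring_hom_mult ring_hom_sum ring_hom_prod ring_hom_power ring_hom_of_nat ring_hom_of_int

end

lemma ring_hom_comp: "ring_hom g \<Longrightarrow> ring_hom h \<Longrightarrow> ring_hom (\<lambda>x. g (h x))"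
  by (simp add: ring_hom_def)

text \<open>An exponential law for \<open>F\<close> makes its linear extension multiplicative.
  Stated for arbitrary exponents, it serves \<open>subst_poly\<close> as well as the operations on
  Laurent polynomials.\<close>

lemma ring_hom_lin_ext:
  fixes F :: "'a::comm_monoid_add \<Rightarrow> 'r::comm_ring_1"
  assumes F0: "F 0 = 1" and F_add: "\<And>a b. F (a + b) = F a * F b"
  shows "ring_hom (lin_ext F)"
proof (rule ring_homI)
  show "lin_ext F 1 = 1" by (simp add: F0 flip: single_one)
  show "lin_ext F (f + g) = lin_ext F f + lin_ext F g" for f g by (rule lin_ext_add)
  show "lin_ext F (f * g) = lin_ext F f * lin_ext F g" for f g
  proof (induction f rule: poly_mapping_add_single_induct)
    case (add f e c)
    have "lin_ext F (Poly_Mapping.single e c * g) = of_int c * F e * lin_ext F g"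
      by (induction g rule: poly_mapping_add_single_induct)
        (auto simp: lin_ext_add ring_distribs mult_single F_add)
    then show ?case using add by (simp add: lin_ext_add ring_distribs)
  qed simp
qed

lemma subst_poly_lin_ext:
  "subst_poly \<phi> = lin_ext (\<lambda>e. \<Prod>i\<in>Poly_Mapping.keys e. \<phi> i ^ Poly_Mapping.lookup e i)"
  by (simp add: fun_eq_iff subst_poly_def lin_ext_def)

lemma prod_power_superset:
  assumes "finite A" "Poly_Mapping.keys e \<subseteq> A"
  shows "(\<Prod>i\<in>Poly_Mapping.keys e. \<phi> i ^ Poly_Mapping.lookup e i)
    = (\<Prod>i\<in>A. (\<phi> i :: 'a::comm_ring_1) ^ Poly_Mapping.lookup e i)"
  by (rule prod.mono_neutral_left) (use assms in \<open>auto simp: in_keys_iff\<close>)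

lemma ring_hom_subst_poly: "ring_hom (subst_poly \<phi>)"
  unfolding subst_poly_lin_ext
proof (rule ring_hom_lin_ext)
  fix a b :: "nat \<Rightarrow>\<^sub>0 nat"
  let ?A = "Poly_Mapping.keys a \<union> Poly_Mapping.keys b"
  have "(\<Prod>i\<in>Poly_Mapping.keys (a + b). \<phi> i ^ Poly_Mapping.lookup (a + b) i)
      = (\<Prod>i\<in>?A. \<phi> i ^ Poly_Mapping.lookup (a + b) i)"
    by (rule prod_power_superset[OF _ keys_add]) simp
  also have "\<dots> = (\<Prod>i\<in>?A. \<phi> i ^ Poly_Mapping.lookup a i) * (\<Prod>i\<in>?A. \<phi> i ^ Poly_Mapping.lookup b i)"
    by (simp add: lookup_add power_add prod.distrib)
  finally show "(\<Prod>i\<in>Poly_Mapping.keys (a + b). \<phi> i ^ Poly_Mapping.lookup (a + b) i) =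
    (\<Prod>i\<in>Poly_Mapping.keys a. \<phi> i ^ Poly_Mapping.lookup a i) *
    (\<Prod>i\<in>Poly_Mapping.keys b. \<phi> i ^ Poly_Mapping.lookup b i)"
    by (simp add: prod_power_superset[of ?A a] prod_power_superset[of ?A b])
qed simp

lemma subst_poly_X [simp]: "subst_poly \<phi> (X i) = \<phi> i"
  by (simp add: X_def subst_poly_lin_ext)

lemmas subst_poly_simps = ring_hom_simps[OF ring_hom_subst_poly]

lemma single_power: "Poly_Mapping.single (Poly_Mapping.single i (1::nat)) (1::int) ^ k
  = Poly_Mapping.single (Poly_Mapping.single i k) 1"
  by (induction k) (auto simp: mult_single simp flip: single_add)

lemma monomial_eq_prod_X:
  "Poly_Mapping.single e 1 = (\<Prod>i\<in>Poly_Mapping.keys e. X i ^ Poly_Mapping.lookup e i)"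
proof -
  have "(\<Prod>i\<in>A. Poly_Mapping.single (g i) (1::int)) = Poly_Mapping.single (\<Sum>i\<in>A. g i) 1"
    for g :: "nat \<Rightarrow> nat \<Rightarrow>\<^sub>0 nat" and A
    by (induction A rule: infinite_finite_induct) (auto simp: mult_single)
  moreover have "(\<Sum>i\<in>Poly_Mapping.keys e. Poly_Mapping.single i (Poly_Mapping.lookup e i)) = e"
    by (rule poly_mapping_eqI)
      (auto simp: lookup_sum lookup_single when_def in_keys_iff)
  ultimately show ?thesis by (simp add: X_def single_power del: One_nat_def)
qed

lemma poly_ring_induct [case_names const var add mult]:
  assumes const: "\<And>c. P (of_int c)" and var: "\<And>i. P (X i)"
    and add: "\<And>f g. P f \<Longrightarrow> P g \<Longrightarrow> P (f + g)" and mult: "\<And>f g. P f \<Longrightarrow> P g \<Longrightarrow> P (f * g)"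
  shows "P (f :: poly_ring)"
proof (induction f rule: poly_mapping_add_single_induct)
  case zero
  show ?case using const[of 0] by simp
next
  case (add f e c)
  have pow: "P (X i ^ k)" for i k
    by (induction k) (use const[of 1] var mult in auto)
  have "P (\<Prod>i\<in>A. X i ^ a i)" for A a
    by (induction A rule: infinite_finite_induct) (use const[of 1] pow mult in auto)
  then have "P (Poly_Mapping.single e 1)" by (simp add: monomial_eq_prod_X)
  then have "P (of_int c * Poly_Mapping.single e 1)" using const mult by blast
  moreover have "of_int c * Poly_Mapping.single e 1 = Poly_Mapping.single e c"
    by (simp flip: single_of_int add: mult_single)
  ultimately show ?case using add assms(3) by metis
qed

text \<open>All ring homomorphisms agree on integer constants, so only the variables matter.
  Compositions of substitutions are compared this way throughout.\<close>

lemma ring_hom_poly_eqI: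
  assumes "ring_hom g" "ring_hom h" "\<And>i. g (X i) = h (X i)"
  shows "g (f :: poly_ring) = h f"
  by (induction f rule: poly_ring_induct)
    (use assms in \<open>auto simp: ring_hom_simps[OF assms(1)] ring_hom_simps[OF assms(2)]\<close>)

lemma ring_hom_subst_poly_eq:
  assumes "ring_hom h"
  shows "h (subst_poly \<phi> f) = subst_poly (\<lambda>i. h (\<phi> i)) f"
  by (rule ring_hom_poly_eqI[of "\<lambda>f. h (subst_poly \<phi> f)"])
    (auto intro: ring_hom_comp assms ring_hom_subst_poly)

lemma subst_poly_subst_poly:
  "subst_poly \<psi> (subst_poly \<phi> f) = subst_poly (\<lambda>i. subst_poly \<psi> (\<phi> i)) f"
  by (rule ring_hom_subst_poly_eq[OF ring_hom_subst_poly])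

lemma subst_poly_id: "subst_poly X f = f"
  by (rule ring_hom_poly_eqI[of "subst_poly X" "\<lambda>f. f"])
    (simp_all add: ring_hom_subst_poly, simp add: ring_hom_def)

subsection \<open>Divided differences\<close>

definition swap_vars :: "nat \<Rightarrow> poly_ring \<Rightarrow> poly_ring" where
  "swap_vars i = subst_poly (\<lambda>j. X (transpose i (Suc i) j))"

lemma ring_hom_swap_vars: "ring_hom (swap_vars i)"
  unfolding swap_vars_def by (rule ring_hom_subst_poly)

lemmas swap_vars_simps = ring_hom_simps[OF ring_hom_swap_vars]

lemma swap_vars_X [simp]: "swap_vars i (X j) = X (transpose i (Suc i) j)"
  by (simp add: swap_vars_def)

lemma subst_poly_swap_vars:
  "subst_poly \<phi> (swap_vars i f) = subst_poly (\<lambda>j. \<phi> (transpose i (Suc i) j)) f"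
  by (simp add: swap_vars_def subst_poly_subst_poly)

lemma swap_vars_swap_vars [simp]: "swap_vars i (swap_vars i f) = f"
  by (subst swap_vars_def) (simp add: subst_poly_swap_vars subst_poly_id)

lemma X_diff_neq_0: "i \<noteq> j \<Longrightarrow> X i - X j \<noteq> 0"
  using X_neq by simp

lemma divided_difference_eqI':
  "g * (X i - X (Suc i)) = f - swap_vars i f \<Longrightarrow> divided_difference i f = g"
  by (rule divided_difference_eqI) (simp add: swap_vars_def)

text \<open>Without this divisibility the \<open>THE\<close> in \<open>divided_difference\<close>
  would be unspecified. The quotient is explicit on generators and is carried through sums and
  products.\<close>

lemma divided_difference_exists: "\<exists>g. g * (X i - X (Suc i)) = f - swap_vars i f"
proof (induction f rule: poly_ring_induct)
  case (const c)
  show ?case by (rule exI[of _ 0]) (simp add: swap_vars_simps)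
next
  case (var j)
  show ?case
    by (rule exI[of _ "if j = i then 1 else if j = Suc i then -1 else 0"])
      (auto simp: transpose_def)
next
  case (add f g)
  then show ?case by (metis (no_types, opaque_lifting) add_diff_add distrib_right swap_vars_simps(3))
next
  case (mult f g)
  then obtain a b where ab: "a * (X i - X (Suc i)) = f - swap_vars i f"
    "b * (X i - X (Suc i)) = g - swap_vars i g" by blast
  \<comment> \<open>The witness is the twisted Leibniz rule, from
    \<open>f g - sf sg = (f - sf) g + sf (g - sg)\<close> with \<open>s\<close> the swap.\<close>
  have "(a * g + swap_vars i f * b) * (X i - X (Suc i))
      = a * (X i - X (Suc i)) * g + swap_vars i f * (b * (X i - X (Suc i)))"
    by (simp add: algebra_simps)
  also have "\<dots> = f * g - swap_vars i (f * g)"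
    unfolding ab by (simp add: swap_vars_simps algebra_simps)
  finally show ?case by blast
qed

lemma divided_difference_eq:
  "divided_difference i f * (X i - X (Suc i)) = f - swap_vars i f"
  using divided_difference_exists[of i f] divided_difference_eqI' by metis

lemma divided_difference_mult:
  "divided_difference i (f * g) = divided_difference i f * g + swap_vars i f * divided_difference i g"
proof (rule divided_difference_eqI')
  have "(divided_difference i f * g + swap_vars i f * divided_difference i g) * (X i - X (Suc i))
      = divided_difference i f * (X i - X (Suc i)) * g
        + swap_vars i f * (divided_difference i g * (X i - X (Suc i)))"
    by (simp add: algebra_simps)
  also have "\<dots> = f * g - swap_vars i (f * g)"
    unfolding divided_difference_eq by (simp add: swap_vars_simps algebra_simps)
  finally show "(divided_difference i f * g + swap_vars i f * divided_difference i g) * (X i - X (Suc i))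
    = f * g - swap_vars i (f * g)" .
qed

lemma divided_difference_add:
  "divided_difference i (f + g) = divided_difference i f + divided_difference i g"
  by (rule divided_difference_eqI') (simp add: distrib_right divided_difference_eq swap_vars_simps)

lemma divided_difference_uminus: "divided_difference i (- f) = - divided_difference i f"
  by (rule divided_difference_eqI') (simp add: divided_difference_eq swap_vars_simps)

lemma divided_difference_diff:
  "divided_difference i (f - g) = divided_difference i f - divided_difference i g"
  using divided_difference_add[of i f "- g"] by (simp add: divided_difference_uminus)

lemma divided_difference_eq_0_iff: "divided_difference i f = 0 \<longleftrightarrow> swap_vars i f = f"
  using divided_difference_eq[of i f] X_diff_neq_0[of i "Suc i"]
  by (metis divided_difference_eqI' eq_iff_diff_eq_0 mult_zero_left n_not_Suc_n)

lemma divided_difference_0 [simp]: "divided_difference i 0 = 0"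
  by (simp add: divided_difference_eq_0_iff swap_vars_simps)

lemma divided_difference_of_nat [simp]: "divided_difference i (of_nat c) = 0"
  by (simp add: divided_difference_eq_0_iff swap_vars_simps)

lemma divided_difference_sum:
  "divided_difference i (sum f A) = (\<Sum>j\<in>A. divided_difference i (f j))"
  by (induction A rule: infinite_finite_induct) (auto simp: divided_difference_add)

lemma divided_difference_X:
  "divided_difference i (X j) = (if j = i then 1 else if j = Suc i then - 1 else 0)"
  by (rule divided_difference_eqI') (auto simp: transpose_def)

text \<open>The swap changes the sign of both numerator and denominator.\<close>

lemma swap_vars_divided_difference:
  "swap_vars i (divided_difference i f) = divided_difference i f"
proof -
  have "swap_vars i (divided_difference i f) * (X (Suc i) - X i) = swap_vars i f - f"
    using arg_cong[OF divided_difference_eq[of i f], of "swap_vars i"]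
    by (simp add: swap_vars_simps)
  then have "swap_vars i (divided_difference i f) * (X i - X (Suc i))
    = divided_difference i f * (X i - X (Suc i))"
    unfolding divided_difference_eq by (simp add: algebra_simps)
  then show ?thesis using X_diff_neq_0[of i "Suc i"] by simp
qed

lemma divided_difference_sym_mult:
  "swap_vars i f = f \<Longrightarrow> divided_difference i (f * g) = f * divided_difference i g"
  by (metis add_0_left divided_difference_eq_0_iff divided_difference_mult mult_zero_left)

lemma divided_difference_twice [simp]:
  "divided_difference i (divided_difference i f) = 0"
  by (simp add: divided_difference_eq_0_iff swap_vars_divided_difference)

lemma swap_vars_commute:
  assumes "Suc i < j"
  shows "swap_vars i (swap_vars j f) = swap_vars j (swap_vars i f)"
proof -
  have "X (transpose i (Suc i) (transpose j (Suc j) k)) = X (transpose j (Suc j) (transpose i (Suc i) k))"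
    for k using assms by (auto simp: transpose_def)
  then show ?thesis
    by (subst (1 3) swap_vars_def) (simp add: subst_poly_swap_vars swap_vars_def subst_poly_subst_poly)
qed

text \<open>Each swap fixes the other denominator, so both sides, multiplied by the two
  denominators, become the same alternating sum of four terms.\<close>

lemma divided_difference_commute:
  assumes "Suc i < j"
  shows "divided_difference i (divided_difference j f) = divided_difference j (divided_difference i f)"
proof -
  have fix_i: "swap_vars j (X i - X (Suc i)) = X i - X (Suc i)"
    and fix_j: "swap_vars i (X j - X (Suc j)) = X j - X (Suc j)"
    using assms by (auto simp: swap_vars_simps transpose_def)
  have A: "divided_difference i (divided_difference j f) * ((X i - X (Suc i)) * (X j - X (Suc j)))
    = (f - swap_vars j f) - swap_vars i (f - swap_vars j f)"
  proof -
    have "divided_difference i (divided_difference j f) * ((X i - X (Suc i)) * (X j - X (Suc j)))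
      = (divided_difference j f - swap_vars i (divided_difference j f)) * (X j - X (Suc j))"
      by (simp only: divided_difference_eq mult.assoc[symmetric])
    also have "\<dots> = divided_difference j f * (X j - X (Suc j))
      - swap_vars i (divided_difference j f * (X j - X (Suc j)))"
      by (simp only: ring_hom_mult[OF ring_hom_swap_vars] fix_j left_diff_distrib)
    finally show ?thesis by (simp only: divided_difference_eq)
  qed
  have B: "divided_difference j (divided_difference i f) * ((X i - X (Suc i)) * (X j - X (Suc j)))
    = (f - swap_vars i f) - swap_vars j (f - swap_vars i f)"
  proof -
    have "divided_difference j (divided_difference i f) * ((X i - X (Suc i)) * (X j - X (Suc j)))
      = (divided_difference i f - swap_vars j (divided_difference i f)) * (X i - X (Suc i))"
    proof -
      have "divided_difference j (divided_difference i f) * ((X i - X (Suc i)) * (X j - X (Suc j)))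
        = divided_difference j (divided_difference i f) * (X j - X (Suc j)) * (X i - X (Suc i))"
        by (simp only: mult_ac)
      then show ?thesis by (simp only: divided_difference_eq)
    qed
    also have "\<dots> = divided_difference i f * (X i - X (Suc i))
      - swap_vars j (divided_difference i f * (X i - X (Suc i)))"
      by (simp only: ring_hom_mult[OF ring_hom_swap_vars] fix_i left_diff_distrib)
    finally show ?thesis by (simp only: divided_difference_eq)
  qed
  have "(f - swap_vars j f) - swap_vars i (f - swap_vars j f)
    = (f - swap_vars i f) - swap_vars j (f - swap_vars i f)"
    using swap_vars_commute[OF assms] by (simp add: swap_vars_simps)
  then have "divided_difference i (divided_difference j f) * ((X i - X (Suc i)) * (X j - X (Suc j)))
    = divided_difference j (divided_difference i f) * ((X i - X (Suc i)) * (X j - X (Suc j)))"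
    by (simp only: A B)
  moreover have "(X i - X (Suc i)) * (X j - X (Suc j)) \<noteq> 0"
    using X_diff_neq_0 by simp
  ultimately show ?thesis by (rule mult_right_cancel[THEN iffD1, rotated])
qed

lemma swap_vars_braid:
  "swap_vars i (swap_vars (Suc i) (swap_vars i f)) = swap_vars (Suc i) (swap_vars i (swap_vars (Suc i) f))"
proof -
  have "X (transpose i (Suc i) (transpose (Suc i) (Suc (Suc i)) (transpose i (Suc i) k)))
    = X (transpose (Suc i) (Suc (Suc i)) (transpose i (Suc i) (transpose (Suc i) (Suc (Suc i)) k)))" for k
    by (auto simp: transpose_def)
  then show ?thesis
    by (subst (1 4) swap_vars_def) (simp add: subst_poly_swap_vars swap_vars_def subst_poly_subst_poly)
qed

text \<open>Multiplied by the Vandermonde product of the three variables, each side becomes the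
  alternating sum over the six permutations of these variables. \<open>swap_vars_braid\<close>
  identifies the terms of the longest permutation.\<close>

lemma divided_difference_braid:
  "divided_difference i (divided_difference (Suc i) (divided_difference i f))
    = divided_difference (Suc i) (divided_difference i (divided_difference (Suc i) f))"
proof -
  define a b c where "a = X i" and "b = X (Suc i)" and "c = X (Suc (Suc i))"
  have sa: "swap_vars i a = b" "swap_vars i b = a" "swap_vars i c = c"
    "swap_vars (Suc i) a = a" "swap_vars (Suc i) b = c" "swap_vars (Suc i) c = b"
    by (simp_all add: a_def b_def c_def transpose_def)
  have eqs: "divided_difference i f * (a - b) = f - swap_vars i f"
    "divided_difference (Suc i) f * (b - c) = f - swap_vars (Suc i) f" for f
    using divided_difference_eq[of i f] divided_difference_eq[of "Suc i" f]
    by (simp_all add: a_def b_def c_def)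
  have nz: "(a - b) * (a - c) * (b - c) \<noteq> 0"
    using X_diff_neq_0 by (simp add: a_def b_def c_def)
  let ?s = "swap_vars i" and ?t = "swap_vars (Suc i)"
  have L: "divided_difference i (divided_difference (Suc i) (divided_difference i f)) * ((a - b) * (a - c) * (b - c))
    = f - ?s f - ?t f + ?t (?s f) + ?s (?t f) - ?s (?t (?s f))"
  proof -
    define g h k where "g = divided_difference i f" "h = divided_difference (Suc i) g"
      "k = divided_difference i h"
    have 1: "g * (a - b) = f - ?s f" "h * (b - c) = g - ?t g" "k * (a - b) = h - ?s h"
      unfolding g_h_k_def by (rule eqs)+
    \<comment> \<open>Applying a swap to a defining equation permutes its denominator too; this is
      where the factor \<open>a - c\<close> comes from.\<close>
    have 2: "?t g * (a - c) = ?t f - ?t (?s f)"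
      using arg_cong[OF 1(1), of ?t] by (simp add: swap_vars_simps sa)
    have 3: "?s (?t g) * (b - c) = ?s (?t f) - ?s (?t (?s f))"
      using arg_cong[OF 2, of ?s] by (simp add: swap_vars_simps sa)
    have 4: "?s h * (a - c) = g - ?s (?t g)"
      using arg_cong[OF 1(2), of ?s] swap_vars_divided_difference[of i f]
      by (simp add: swap_vars_simps sa g_h_k_def(1))
    have "k * ((a - b) * (a - c) * (b - c)) = (k * (a - b)) * (a - c) * (b - c)"
      by (simp add: algebra_simps)
    also have "\<dots> = (h * (b - c)) * (a - c) - (?s h * (a - c)) * (b - c)"
      unfolding 1(3) by (simp add: algebra_simps)
    also have "\<dots> = g * (a - b) - ?t g * (a - c) + ?s (?t g) * (b - c)"
      unfolding 1(2) 4 by (simp add: algebra_simps)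
    also have "\<dots> = f - ?s f - ?t f + ?t (?s f) + ?s (?t f) - ?s (?t (?s f))"
      unfolding 1(1) 2 3 by simp
    finally show ?thesis unfolding g_h_k_def .
  qed
  have R: "divided_difference (Suc i) (divided_difference i (divided_difference (Suc i) f)) * ((a - b) * (a - c) * (b - c))
    = f - ?t f - ?s f + ?s (?t f) + ?t (?s f) - ?t (?s (?t f))"
  proof -
    define g h k where "g = divided_difference (Suc i) f" "h = divided_difference i g"
      "k = divided_difference (Suc i) h"
    have 1: "g * (b - c) = f - ?t f" "h * (a - b) = g - ?s g" "k * (b - c) = h - ?t h"
      unfolding g_h_k_def by (rule eqs)+
    have 2: "?s g * (a - c) = ?s f - ?s (?t f)"
      using arg_cong[OF 1(1), of ?s] by (simp add: swap_vars_simps sa)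
    have 3: "?t (?s g) * (a - b) = ?t (?s f) - ?t (?s (?t f))"
      using arg_cong[OF 2, of ?t] by (simp add: swap_vars_simps sa)
    have 4: "?t h * (a - c) = g - ?t (?s g)"
      using arg_cong[OF 1(2), of ?t] swap_vars_divided_difference[of "Suc i" f]
      by (simp add: swap_vars_simps sa g_h_k_def(1))
    have "k * ((a - b) * (a - c) * (b - c)) = (k * (b - c)) * (a - c) * (a - b)"
      by (simp add: algebra_simps)
    also have "\<dots> = (h * (a - b)) * (a - c) - (?t h * (a - c)) * (a - b)"
      unfolding 1(3) by (simp add: algebra_simps)
    also have "\<dots> = g * (b - c) - ?s g * (a - c) + ?t (?s g) * (a - b)"
      unfolding 1(2) 4 by (simp add: algebra_simps)
    also have "\<dots> = f - ?t f - ?s f + ?s (?t f) + ?t (?s f) - ?t (?s (?t f))"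
      unfolding 1(1) 2 3 by simp
    finally show ?thesis unfolding g_h_k_def .
  qed
  have "divided_difference i (divided_difference (Suc i) (divided_difference i f)) * ((a - b) * (a - c) * (b - c))
    = divided_difference (Suc i) (divided_difference i (divided_difference (Suc i) f)) * ((a - b) * (a - c) * (b - c))"
    unfolding L R swap_vars_braid by (simp add: algebra_simps)
  then show ?thesis by (rule mult_right_cancel[OF nz, THEN iffD1])
qed

subsection \<open>Schubert polynomials\<close>

declare One_nat_def [simp del]

abbreviation adj :: "nat \<Rightarrow> nat \<Rightarrow> nat" where
  "adj i \<equiv> transpose i (Suc i)"

lemma permutes_comp_adj:
  "w permutes {1..n} \<Longrightarrow> 1 \<le> i \<Longrightarrow> i < n \<Longrightarrow> (w \<circ> adj i) permutes {1..n}"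
  by (rule permutes_compose[of "adj i"]) (auto intro!: permutes_swap_id)

text \<open>Two ascents \<open>i < j\<close> lead to a common longer permutation: \<open>w\<close>
  followed by both swaps if they are far apart, by the braid of length three if they are adjacent.
  \<open>IH\<close> allows both routes to be continued up to it, where the relations between divided
  differences apply.\<close>

lemma divided_difference_diamond:
  assumes w: "w permutes {1..n}" and i: "1 \<le> i" "i < j" "j < n"
    and asc: "w i < w (Suc i)" "w j < w (Suc j)"
    and IH: "\<And>w' k. card (noninversions n w') < card (noninversions n w) \<Longrightarrow> w' permutes {1..n} \<Longrightarrow>
      1 \<le> k \<Longrightarrow> k < n \<Longrightarrow> w' k < w' (Suc k) \<Longrightarrow>
      schubert n w' = divided_difference k (schubert n (w' \<circ> adj k))"
  shows "divided_difference i (schubert n (w \<circ> adj i)) = divided_difference j (schubert n (w \<circ> adj j))"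
proof (cases "j = Suc i")
  case False
  then have ij: "Suc i < j" using i by simp
  have "schubert n (w \<circ> adj i) = divided_difference j (schubert n (w \<circ> adj i \<circ> adj j))"
    by (rule IH) (use w i asc ij in \<open>auto intro!: card_noninversions_decreases permutes_comp_adj simp: transpose_def\<close>)
  moreover have "schubert n (w \<circ> adj j) = divided_difference i (schubert n (w \<circ> adj j \<circ> adj i))"
    by (rule IH) (use w i asc ij in \<open>auto intro!: card_noninversions_decreases permutes_comp_adj simp: transpose_def\<close>)
  moreover have "w \<circ> adj i \<circ> adj j = w \<circ> adj j \<circ> adj i"
    using ij by (auto simp: fun_eq_iff transpose_def)
  ultimately show ?thesis using divided_difference_commute[OF ij] by simp
next
  case True
  have perms: "(w \<circ> adj i) permutes {1..n}" "(w \<circ> adj i \<circ> adj j) permutes {1..n}"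
     "(w \<circ> adj j) permutes {1..n}" "(w \<circ> adj j \<circ> adj i) permutes {1..n}"
    using w i by (auto intro!: permutes_comp_adj)
  have less: "card (noninversions n (w \<circ> adj i)) < card (noninversions n w)"
    "card (noninversions n (w \<circ> adj j)) < card (noninversions n w)"
    "card (noninversions n (w \<circ> adj i \<circ> adj j)) < card (noninversions n (w \<circ> adj i))"
    "card (noninversions n (w \<circ> adj j \<circ> adj i)) < card (noninversions n (w \<circ> adj j))"
    by (rule card_noninversions_decreases; use i asc True in \<open>simp add: transpose_def\<close>)+
  have "schubert n (w \<circ> adj i) = divided_difference j (schubert n (w \<circ> adj i \<circ> adj j))"
    by (rule IH) (use perms less i asc True in \<open>auto simp: transpose_def\<close>)
  moreover have "schubert n (w \<circ> adj i \<circ> adj j)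
      = divided_difference i (schubert n (w \<circ> adj i \<circ> adj j \<circ> adj i))"
    by (rule IH) (use perms less i asc True in \<open>auto simp: transpose_def\<close>)
  moreover have "schubert n (w \<circ> adj j) = divided_difference i (schubert n (w \<circ> adj j \<circ> adj i))"
    by (rule IH) (use perms less i asc True in \<open>auto simp: transpose_def\<close>)
  moreover have "schubert n (w \<circ> adj j \<circ> adj i)
      = divided_difference j (schubert n (w \<circ> adj j \<circ> adj i \<circ> adj j))"
    by (rule IH) (use perms less i asc True in \<open>auto simp: transpose_def\<close>)
  moreover have "w \<circ> adj i \<circ> adj j \<circ> adj i = w \<circ> adj j \<circ> adj i \<circ> adj j"
    using True by (auto simp: fun_eq_iff transpose_def)
  ultimately show ?thesis using divided_difference_braid[of i] True by simp
qed

text \<open>Well-definedness: the recursion holds at every ascent and not just at the one picked by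
  \<open>SOME\<close>. The diamond lemma compares the two.\<close>

lemma schubert_ascent:
  assumes "w permutes {1..n}" "1 \<le> i" "i < n" "w i < w (Suc i)"
  shows "schubert n w = divided_difference i (schubert n (w \<circ> adj i))"
  using assms
proof (induction "card (noninversions n w)" arbitrary: w i rule: less_induct)
  case less
  define k where "k = (SOME i. 1 \<le> i \<and> i < n \<and> w i < w (Suc i))"
  have k: "1 \<le> k \<and> k < n \<and> w k < w (Suc k)"
    unfolding k_def by (rule someI_ex) (use less.prems in blast)
  have "w \<noteq> longest_perm n"
    using less.prems by (auto simp: longest_perm_def)
  then have "schubert n w = divided_difference k (schubert n (w \<circ> adj k))"
    using less.prems(1) by (simp add: schubert.simps[of n w] k_def Let_def)
  also have "\<dots> = divided_difference i (schubert n (w \<circ> adj i))"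
  proof (cases i k rule: linorder_cases)
    case less': less
    show ?thesis
      by (rule divided_difference_diamond[symmetric]) (use less less' k in auto)
  next
    case greater
    show ?thesis
      by (rule divided_difference_diamond) (use less greater k in auto)
  qed simp
  finally show ?case .
qed

section \<open>Lehmer codes and dominant permutations\<close>

definition lehmer :: "nat \<Rightarrow> (nat \<Rightarrow> nat) \<Rightarrow> nat \<Rightarrow> nat" where
  "lehmer n w i = card {j. i < j \<and> j \<le> n \<and> w j < w i}"

lemma finite_between [simp]: "finite {j::nat. i < j \<and> j \<le> n \<and> P j}"
  by (rule finite_subset[of _ "{..n}"]) auto

lemma lehmer_ascent: "w i < w (Suc i) \<Longrightarrow> lehmer n w i \<le> lehmer n w (Suc i)"
  unfolding lehmer_def
  by (rule card_mono) (auto, metis Suc_lessI dual_order.strict_trans less_irrefl)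

lemma lehmer_descent:
  assumes "i < n" "w (Suc i) < w i"
  shows "Suc (lehmer n w (Suc i)) \<le> lehmer n w i"
proof -
  have "Suc (lehmer n w (Suc i)) = card (insert (Suc i) {j. Suc i < j \<and> j \<le> n \<and> w j < w (Suc i)})"
    by (simp add: lehmer_def)
  also have "\<dots> \<le> lehmer n w i"
    unfolding lehmer_def by (rule card_mono) (use assms in auto)
  finally show ?thesis .
qed

text \<open>Only the pair at \<open>i\<close>, \<open>Suc i\<close> changes its relative order: the
  larger entry moves to position \<open>i\<close> and now has the smaller one behind it.\<close>

lemma lehmer_comp_adj:
  assumes i: "i < n" and asc: "w i < w (Suc i)"
  shows "lehmer n (w \<circ> adj i) i = Suc (lehmer n w (Suc i))"
    and "lehmer n (w \<circ> adj i) (Suc i) = lehmer n w i"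
    and "k \<noteq> i \<Longrightarrow> k \<noteq> Suc i \<Longrightarrow> lehmer n (w \<circ> adj i) k = lehmer n w k"
proof -
  have "{j. i < j \<and> j \<le> n \<and> (w \<circ> adj i) j < (w \<circ> adj i) i}
      = insert (Suc i) {j. Suc i < j \<and> j \<le> n \<and> w j < w (Suc i)}"
    using i asc by (auto simp: transpose_def split: if_splits)
  then show "lehmer n (w \<circ> adj i) i = Suc (lehmer n w (Suc i))"
    by (simp add: lehmer_def)
  have "{j. Suc i < j \<and> j \<le> n \<and> (w \<circ> adj i) j < (w \<circ> adj i) (Suc i)} = {j. i < j \<and> j \<le> n \<and> w j < w i}"
    using i asc by (auto simp: transpose_def split: if_splits)
  then show "lehmer n (w \<circ> adj i) (Suc i) = lehmer n w i"
    by (simp add: lehmer_def)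
  assume k: "k \<noteq> i" "k \<noteq> Suc i"
  have "{j. k < j \<and> j \<le> n \<and> (w \<circ> adj i) j < (w \<circ> adj i) k} = adj i ` {j. k < j \<and> j \<le> n \<and> w j < w k}"
    (is "?A = adj i ` ?B")
  proof
    show "adj i ` ?B \<subseteq> ?A" using k i by (auto simp: transpose_def)
    show "?A \<subseteq> adj i ` ?B"
    proof
      fix j assume "j \<in> ?A"
      then have "adj i j \<in> ?B" using k i by (auto simp: transpose_def split: if_splits)
      then show "j \<in> adj i ` ?B" by (metis image_eqI transpose_involutory)
    qed
  qed
  then show "lehmer n (w \<circ> adj i) k = lehmer n w k"
    by (simp add: lehmer_def card_image)
qed

lemma swap_vars_monomial:
  assumes i: "1 \<le> i" "i < n" and c: "c i = c (Suc i)"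
  shows "swap_vars i (\<Prod>j\<in>{1..n}. X j ^ c j) = (\<Prod>j\<in>{1..n}. X j ^ c j)"
proof -
  have "adj i permutes {1..n}" using i by (auto intro: permutes_swap_id)
  then have bij: "bij_betw (adj i) {1..n} {1..n}" by (rule permutes_imp_bij)
  have "swap_vars i (\<Prod>j\<in>{1..n}. X j ^ c j) = (\<Prod>j\<in>{1..n}. X (adj i j) ^ c j)"
    by (simp add: swap_vars_simps)
  also have "\<dots> = (\<Prod>j\<in>{1..n}. X (adj i j) ^ c (adj i j))"
    by (rule prod.cong) (auto simp: transpose_def c)
  also have "\<dots> = (\<Prod>j\<in>{1..n}. X j ^ c j)"
    by (rule prod.reindex_bij_betw[OF bij])
  finally show ?thesis .
qed

lemma schubert_longest: "schubert n (longest_perm n) = (\<Prod>i\<in>{1..n}. X i ^ (n - i))"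
  by (simp add: schubert.simps)

text \<open>Induct upwards through the first ascent \<open>i\<close>: all previous positions are descents, so the
  code stays weakly decreasing after its \<open>i\<close>th entry is raised by one.\<close>

lemma schubert_dominant:
  assumes "w permutes {1..n}" and "\<And>i. 1 \<le> i \<Longrightarrow> i < n \<Longrightarrow> lehmer n w (Suc i) \<le> lehmer n w i"
  shows "schubert n w = (\<Prod>i\<in>{1..n}. X i ^ lehmer n w i)"
  using assms
proof (induction "card (noninversions n w)" arbitrary: w rule: less_induct)
  case less
  show ?case
  proof (cases "w = longest_perm n")
    case True
    have "lehmer n w i = n - i" if "i \<in> {1..n}" for i
    proof -
      have "{j. i < j \<and> j \<le> n \<and> w j < w i} = {i<..n}"
        using that by (auto simp: True longest_perm_def)
      then show ?thesis by (simp add: lehmer_def)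
    qed
    then show ?thesis by (simp add: True schubert_longest)
  next
    case False
    define i where "i = (LEAST i. 1 \<le> i \<and> i < n \<and> w i < w (Suc i))"
    have i: "1 \<le> i" "i < n" "w i < w (Suc i)"
      using LeastI_ex[OF ascent_exists[OF less.prems(1) False]] by (simp_all add: i_def)
    have desc: "w (Suc j) < w j" if "1 \<le> j" "j < i" for j
      using not_less_Least[of j "\<lambda>i. 1 \<le> i \<and> i < n \<and> w i < w (Suc i)"] that i
        inj_eq[OF permutes_inj[OF less.prems(1)], of j "Suc j"]
      by (fold i_def) (auto simp: not_less le_less)
    let ?v = "w \<circ> adj i" and ?c = "lehmer n w"
    \<comment> \<open>An ascent makes the code weakly increase, dominance makes it weakly
      decrease.\<close>
    have ci: "?c i = ?c (Suc i)"
      using lehmer_ascent[of w i n] less.prems(2)[of i] i by simp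
    note c = lehmer_comp_adj[of i n w, OF i(2,3)]
    have dom: "lehmer n ?v (Suc j) \<le> lehmer n ?v j" if j: "1 \<le> j" "j < n" for j
    proof -
      consider "Suc j = i" | "j = i" | "j = Suc i" | "Suc j \<noteq> i" "j \<noteq> i" "j \<noteq> Suc i" by blast
      then show ?thesis
      proof cases
        case 1
        then have "lehmer n ?v j = ?c j" using c(3)[of j] by simp
        moreover have "Suc (?c i) \<le> ?c j"
          using 1 lehmer_descent[of j n w] desc[of j] j by simp
        ultimately show ?thesis using c(1) ci 1 by simp
      next
        case 2
        then show ?thesis using c ci by simp
      next
        case 3
        then show ?thesis using c ci less.prems(2)[of "Suc i"] j by simp
      next
        case 4
        then show ?thesis using c(3)[of j] c(3)[of "Suc j"] less.prems(2) j by simp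
      qed
    qed
    have "schubert n ?v = (\<Prod>j\<in>{1..n}. X j ^ lehmer n ?v j)"
      by (rule less.hyps)
        (use dom i less.prems(1) in \<open>auto intro!: card_noninversions_decreases permutes_comp_adj\<close>)
    also have "\<dots> = (\<Prod>j\<in>{1..n}. X j ^ ?c j * (if j = i then X j else 1))"
    proof (rule prod.cong)
      fix j
      show "X j ^ lehmer n ?v j = X j ^ ?c j * (if j = i then X j else 1)"
        using c(1,2) c(3)[of j] ci by (cases "j = i"; cases "j = Suc i") auto
    qed simp
    also have "\<dots> = (\<Prod>j\<in>{1..n}. X j ^ ?c j) * X i"
      using i by (simp add: prod.distrib)
    finally have "schubert n w = divided_difference i ((\<Prod>j\<in>{1..n}. X j ^ ?c j) * X i)"
      using schubert_ascent[OF less.prems(1) i] by simp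
    \<comment> \<open>By \<open>ci\<close> the monomial is symmetric in the two variables, so the
      divided difference acts on the extra factor \<open>X i\<close> only.\<close>
    also have "\<dots> = (\<Prod>j\<in>{1..n}. X j ^ ?c j)"
      using divided_difference_sym_mult[OF swap_vars_monomial[OF i(1,2) ci]]
      by (simp add: divided_difference_X)
    finally show ?thesis .
  qed
qed

text \<open>At an ascent, a later entry below \<open>w (Suc i)\<close> but above \<open>w i\<close>
  would complete a 132 pattern; hence both positions count the same later entries. Descents satisfy
  the inequality for every permutation.\<close>

lemma lehmer_decreasing_if_avoids_132:
  assumes w: "w permutes {1..n}" and avoids: "avoids_132 n w" and i: "1 \<le> i" "i < n"
  shows "lehmer n w (Suc i) \<le> lehmer n w i"
proof (cases "w i < w (Suc i)")
  case True
  have "w j < w i" if "Suc i < j" "j \<le> n" "w j < w (Suc i)" for j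
  proof -
    have "\<not> w i < w j" using avoids that i unfolding avoids_132_def by (metis lessI)
    moreover have "w j \<noteq> w i" using that inj_eq[OF permutes_inj[OF w]] by auto
    ultimately show ?thesis by simp
  qed
  then show ?thesis
    unfolding lehmer_def by (intro card_mono) auto
next
  case False
  then have "w (Suc i) < w i"
    using inj_eq[OF permutes_inj[OF w], of i "Suc i"] by (auto simp: not_less le_less)
  then show ?thesis using lehmer_descent[of i n w] i by simp
qed

lemma schubert_avoids_132:
  assumes "w permutes {1..n}" "avoids_132 n w"
  shows "schubert n w = (\<Prod>i\<in>{1..n}. X i ^ lehmer n w i)"
  using schubert_dominant lehmer_decreasing_if_avoids_132 assms by blast

lemma longest_perm_permutes: "longest_perm n permutes {1..n}"
  by (rule bij_imp_permutes, rule bij_betwI[where g = "longest_perm n"])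
    (auto simp: longest_perm_def)

text \<open>Both sides obey the same recursion at ascents inside \<open>{1..n}\<close>. The base
  case is the longest element of the smaller group: in the larger group it is dominant, with code
  \<open>n - i\<close> and a final entry 0.\<close>

lemma schubert_Suc:
  assumes "w permutes {1..n}"
  shows "schubert (Suc n) w = schubert n w"
  using assms
proof (induction "card (noninversions n w)" arbitrary: w rule: less_induct)
  case less
  have perm: "w permutes {1..Suc n}" 
    using less.prems by (rule permutes_subset) auto
  show ?case
  proof (cases "w = longest_perm n")
    case True
    have 1: "lehmer (Suc n) w i = n - i" if "i \<in> {1..Suc n}" for i
    proof -
      have "{j. i < j \<and> j \<le> Suc n \<and> w j < w i} = {i<..n}"
        using that by (auto simp: True longest_perm_def)
      then show ?thesis by (simp add: lehmer_def)
    qed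
    have "schubert (Suc n) w = (\<Prod>i\<in>{1..Suc n}. X i ^ lehmer (Suc n) w i)"
      by (rule schubert_dominant[OF perm]) (auto simp: 1)
    also have "\<dots> = (\<Prod>i\<in>{1..Suc n}. X i ^ (n - i))"
      by (rule prod.cong) (auto simp: 1)
    finally show ?thesis by (simp add: True schubert_longest)
  next
    case False
    obtain i where i: "1 \<le> i" "i < n" "w i < w (Suc i)"
      using ascent_exists[OF less.prems False] by blast
    have "schubert (Suc n) (w \<circ> adj i) = schubert n (w \<circ> adj i)"
      by (rule less.hyps)
        (use i less.prems in \<open>auto intro!: card_noninversions_decreases permutes_comp_adj\<close>)
    then show ?thesis
      using schubert_ascent[OF less.prems i] schubert_ascent[OF perm, of i] i by simp
  qed
qed

lemma permutes_mono: "w permutes {1..n} \<Longrightarrow> n \<le> m \<Longrightarrow> w permutes {1..m::nat}"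
  by (rule permutes_subset) auto

lemma schubert_stable:
  assumes "n \<le> m" "w permutes {1..n}"
  shows "schubert m w = schubert n w"
  using assms
proof (induction m rule: dec_induct)
  case (step m)
  then show ?case using schubert_Suc permutes_mono[of w n m] by simp
qed simp

section \<open>Finitely supported permutations, independent of the ambient symmetric group\<close>

definition fin_perm :: "(nat \<Rightarrow> nat) \<Rightarrow> bool" where
  "fin_perm w \<longleftrightarrow> (\<exists>n. w permutes {1..n})"

text \<open>\<open>LEAST\<close> merely selects some admissible \<open>n\<close>; by stability
  (\<open>sch_eq\<close>) every admissible \<open>n\<close> gives the same polynomial.\<close>

definition sch :: "(nat \<Rightarrow> nat) \<Rightarrow> poly_ring" where
  "sch w = schubert (LEAST n. w permutes {1..n}) w"

lemma sch_eq: "w permutes {1..n} \<Longrightarrow> sch w = schubert n w"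
  unfolding sch_def
  by (rule schubert_stable[symmetric]) (auto intro: LeastI Least_le)

lemma fin_permI [intro]: "w permutes {1..n} \<Longrightarrow> fin_perm w"
  by (auto simp: fin_perm_def)

lemma fin_perm_inj: "fin_perm w \<Longrightarrow> w i = w j \<longleftrightarrow> i = j"
  by (auto simp: fin_perm_def dest: permutes_inj injD)

lemma fin_perm_fixes_0: "fin_perm w \<Longrightarrow> w 0 = 0"
  by (auto simp: fin_perm_def permutes_def)

lemma fin_permE:
  assumes "fin_perm w"
  obtains n where "w permutes {1..n}" "k \<le> n"
  using assms permutes_mono[of w _ "max _ k"] unfolding fin_perm_def by (metis max.cobounded1 max.cobounded2)

lemma fin_perm_comp:
  assumes "fin_perm v" "fin_perm w"
  shows "fin_perm (v \<circ> w)"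
proof -
  obtain m where m: "v permutes {1..m}" using assms(1) by (auto simp: fin_perm_def)
  obtain n where n: "w permutes {1..n}" "m \<le> n" by (rule fin_permE[OF assms(2)])
  show ?thesis
    using permutes_compose[OF n(1) permutes_mono[OF m n(2)]] by blast
qed

lemma fin_perm_transpose: "1 \<le> a \<Longrightarrow> 1 \<le> b \<Longrightarrow> fin_perm (transpose a b)"
  by (rule fin_permI[of _ "max a b"]) (auto intro!: permutes_swap_id)

lemma fin_perm_comp_transpose:
  "fin_perm w \<Longrightarrow> 1 \<le> a \<Longrightarrow> 1 \<le> b \<Longrightarrow> fin_perm (w \<circ> transpose a b)"
  by (intro fin_perm_comp fin_perm_transpose)

lemma fin_perm_ascent_or_descent:
  "fin_perm w \<Longrightarrow> \<not> w i < w (Suc i) \<Longrightarrow> w (Suc i) < w i"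
  using fin_perm_inj[of w i "Suc i"] by simp

lemma divided_difference_sch_descent:
  assumes "fin_perm w" "1 \<le> i" "w (Suc i) < w i"
  shows "divided_difference i (sch w) = sch (w \<circ> adj i)"
proof -
  obtain n where n: "w permutes {1..n}" "Suc i \<le> n" by (rule fin_permE[OF assms(1)])
  have 1: "(w \<circ> adj i) permutes {1..n}" using n assms by (simp add: permutes_comp_adj)
  have "schubert n (w \<circ> adj i) = divided_difference i (schubert n (w \<circ> adj i \<circ> adj i))"
    by (rule schubert_ascent) (use 1 n assms in auto)
  then show ?thesis by (simp add: sch_eq[OF n(1)] sch_eq[OF 1] comp_assoc)
qed

text \<open>At an ascent \<open>sch w\<close> is itself a divided difference with the same index,
  and these square to zero.\<close>

lemma divided_difference_sch_ascent:
  assumes "fin_perm w" "1 \<le> i" "w i < w (Suc i)"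
  shows "divided_difference i (sch w) = 0"
proof -
  have "fin_perm (w \<circ> adj i)" using assms by (intro fin_perm_comp_transpose) auto
  then have "divided_difference i (sch (w \<circ> adj i)) = sch (w \<circ> adj i \<circ> adj i)"
    by (rule divided_difference_sch_descent) (use assms in auto)
  then have "sch w = divided_difference i (sch (w \<circ> adj i))" by (simp add: comp_assoc)
  then show ?thesis by simp
qed

lemma divided_difference_sch:
  assumes "fin_perm w" "1 \<le> i"
  shows "divided_difference i (sch w) = (if w (Suc i) < w i then sch (w \<circ> adj i) else 0)"
  using assms divided_difference_sch_descent divided_difference_sch_ascent fin_perm_ascent_or_descent
  by (metis)

text \<open>On zero letters the identity is the longest element, and its monomial is the empty
  product.\<close>

lemma sch_id: "sch id = 1"
proof -
  have "longest_perm 0 = id" by (auto simp: longest_perm_def)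
  then have "schubert 0 id = 1" using schubert_longest[of 0] by simp
  then show ?thesis by (simp add: sch_eq[of id 0] permutes_id)
qed

text \<open>A strictly increasing map on the naturals lies above the identity; this applies to
  \<open>w\<close> and to its inverse.\<close>

lemma fin_perm_no_descent:
  assumes w: "fin_perm w" and asc: "\<And>i. 1 \<le> i \<Longrightarrow> w i < w (Suc i)"
  shows "w = id"
proof -
  obtain n where n: "w permutes {1..n}" using w by (auto simp: fin_perm_def)
  have "w 0 < w (Suc 0)"
    using fin_perm_inj[OF w, of 0 "Suc 0"] fin_perm_fixes_0[OF w] by simp
  then have mono: "strict_mono w"
    unfolding strict_mono_Suc_iff by (metis asc less_one not_less)
  have "strict_mono (inv w)"
  proof (rule strict_monoI)
    fix a b :: nat assume "a < b"
    then have "w (inv w a) < w (inv w b)" by (simp add: permutes_inverses[OF n])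
    then show "inv w a < inv w b" by (simp add: strict_mono_less[OF mono])
  qed
  then have "k \<le> inv w k" for k by (rule strict_mono_imp_increasing)
  then have "w k \<le> k" for k 
    by (metis mono permutes_inverses(1)[OF n] strict_mono_less_eq)
  moreover have "k \<le> w k" for k using mono by (rule strict_mono_imp_increasing)
  ultimately show ?thesis by (auto intro!: ext simp: order_antisym)
qed

lemma descent_in_range:
  assumes w: "w permutes {1..n}" and "1 \<le> i" and desc: "w (Suc i) < w i"
  shows "i < n"
proof (rule ccontr)
  assume "\<not> i < n"
  then have "w (Suc i) = Suc i" using permutes_not_in[OF w, of "Suc i"] by simp
  moreover have "w i \<le> i"
    using permutes_in_image[OF w, of i] permutes_not_in[OF w, of i] \<open>\<not> i < n\<close>
    by (cases "i \<in> {1..n}") (simp_all only: atLeastAtMost_iff, linarith+)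
  ultimately show False using desc by simp
qed

text \<open>Induction on length. The hypothesis is offered at every descent at once, because
  identities are checked by comparing all divided differences.\<close>

lemma fin_perm_descent_induct [consumes 1, case_names step]:
  assumes "fin_perm w"
    and step: "\<And>w. fin_perm w \<Longrightarrow> (\<And>i. 1 \<le> i \<Longrightarrow> w (Suc i) < w i \<Longrightarrow> P (w \<circ> adj i)) \<Longrightarrow> P w"
  shows "P w"
proof -
  obtain n where n: "w permutes {1..n}" using assms(1) by (auto simp: fin_perm_def)
  show ?thesis using n
  proof (induction "n * n - card (noninversions n w)" arbitrary: w rule: less_induct)
    case less
    show ?case
    proof (rule step)
      show "fin_perm w" using less.prems by blast
      fix i assume i: "1 \<le> i" "w (Suc i) < w i"
      then have "i < n" using descent_in_range[OF less.prems] by simp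
      have "card (noninversions n (w \<circ> adj i \<circ> adj i)) < card (noninversions n (w \<circ> adj i))"
        by (rule card_noninversions_decreases) (use i \<open>i < n\<close> in auto)
      \<comment> \<open>The bound keeps the truncated subtraction in the measure from collapsing to
        0.\<close>
      moreover have "card (noninversions n (w \<circ> adj i)) \<le> card ({1..n} \<times> {1..n})"
        by (rule card_mono) (auto simp: noninversions_def)
      ultimately show "P (w \<circ> adj i)"
        by (intro less.hyps permutes_comp_adj less.prems i \<open>i < n\<close>) (simp add: comp_assoc)
    qed
  qed
qed

lemma fin_perm_induct [consumes 1, case_names id descent]:
  assumes "fin_perm w" and "P id"
    and "\<And>w i. fin_perm w \<Longrightarrow> 1 \<le> i \<Longrightarrow> w (Suc i) < w i \<Longrightarrow> P (w \<circ> adj i) \<Longrightarrow> P w"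
  shows "P w"
  using assms(1)
proof (induction rule: fin_perm_descent_induct)
  case (step w)
  then show ?case
    using fin_perm_no_descent[of w] fin_perm_ascent_or_descent[of w] assms(2,3) by metis
qed

section \<open>Constant terms, homogeneity and linear independence\<close>

definition const_term :: "poly_ring \<Rightarrow> int" where
  "const_term = subst_poly (\<lambda>_. 0)"

text \<open>\<open>drop_var0 f = f\<close> expresses that \<open>f\<close> does not involve
  \<open>X 0\<close>. This must be tracked: divided differences of positive index cannot detect
  \<open>X 0\<close>.\<close>

definition drop_var0 :: "poly_ring \<Rightarrow> poly_ring" where
  "drop_var0 = subst_poly (\<lambda>j. if j = 0 then 0 else X j)"

lemma ring_hom_const_term: "ring_hom const_term"
  unfolding const_term_def by (rule ring_hom_subst_poly)

lemma ring_hom_drop_var0: "ring_hom drop_var0"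
  unfolding drop_var0_def by (rule ring_hom_subst_poly)

lemmas const_term_simps = ring_hom_simps[OF ring_hom_const_term]
lemmas drop_var0_simps = ring_hom_simps[OF ring_hom_drop_var0]

lemma const_term_X [simp]: "const_term (X i) = 0"
  by (simp add: const_term_def)

lemma drop_var0_X: "drop_var0 (X i) = (if i = 0 then 0 else X i)"
  by (simp add: drop_var0_def)

lemma swap_vars_drop_var0:
  assumes "1 \<le> i"
  shows "drop_var0 (swap_vars i f) = swap_vars i (drop_var0 f)"
  by (rule ring_hom_poly_eqI[OF ring_hom_comp[OF ring_hom_drop_var0 ring_hom_swap_vars]
        ring_hom_comp[OF ring_hom_swap_vars ring_hom_drop_var0]])
    (use assms in \<open>auto simp: drop_var0_X swap_vars_simps transpose_def\<close>)

lemma drop_var0_divided_difference: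
  assumes "1 \<le> i" "drop_var0 f = f"
  shows "drop_var0 (divided_difference i f) = divided_difference i f"
proof -
  have "drop_var0 (divided_difference i f) * (X i - X (Suc i)) = f - swap_vars i f"
    using arg_cong[OF divided_difference_eq[of i f], of drop_var0] assms
    by (simp add: drop_var0_simps drop_var0_X swap_vars_drop_var0)
  then show ?thesis by (rule divided_difference_eqI'[symmetric])
qed

text \<open>A symmetric polynomial in infinitely many variables is constant: if \<open>f\<close> involves only
  \<open>X 1, \<dots>, X (Suc M)\<close>, its symmetry in the last of these and the next one shows that \<open>X (Suc M)\<close>
  does not occur either.\<close>

lemma symmetric_imp_constant:
  assumes f0: "drop_var0 f = f" and sym: "\<And>i. 1 \<le> i \<Longrightarrow> divided_difference i f = 0"
  shows "f = of_int (const_term f)"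
proof -
  define trunc :: "nat \<Rightarrow> poly_ring \<Rightarrow> poly_ring" where
    "trunc M = subst_poly (\<lambda>j. if j = 0 \<or> M < j then 0 else X j)" for M
  have trunc_hom: "ring_hom (trunc M)" for M
    unfolding trunc_def by (rule ring_hom_subst_poly)
  note trunc_simps = ring_hom_simps[OF trunc_hom]
  have "\<exists>M. \<forall>M'\<ge>M. trunc M' f = drop_var0 f"
  proof (induction f rule: poly_ring_induct)
    case (const c)
    then show ?case by (simp add: trunc_simps drop_var0_simps)
  next
    case (var i)
    then show ?case by (intro exI[of _ i]) (auto simp: trunc_def drop_var0_X)
  next
    case (add f g)
    then obtain M1 M2 where "\<forall>M'\<ge>M1. trunc M' f = drop_var0 f" "\<forall>M'\<ge>M2. trunc M' g = drop_var0 g"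
      by blast
    then show ?case by (intro exI[of _ "max M1 M2"]) (simp add: trunc_simps drop_var0_simps)
  next
    case (mult f g)
    then obtain M1 M2 where "\<forall>M'\<ge>M1. trunc M' f = drop_var0 f" "\<forall>M'\<ge>M2. trunc M' g = drop_var0 g"
      by blast
    then show ?case by (intro exI[of _ "max M1 M2"]) (simp add: trunc_simps drop_var0_simps)
  qed
  then obtain M where "trunc M f = f" using f0 by fastforce
  then have "trunc 0 f = f"
  proof (induction M)
    case (Suc M)
    have "swap_vars (Suc M) f = f" using sym[of "Suc M"] by (simp add: divided_difference_eq_0_iff)
    \<comment> \<open>The swap sends \<open>X (Suc M)\<close> to \<open>X (Suc (Suc M))\<close>,
      which the outer truncation kills; so this composite is \<open>trunc M\<close>.\<close>
    then have "f = trunc (Suc M) (swap_vars (Suc M) (trunc (Suc M) f))" using Suc.prems by simp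
    also have "\<dots> = trunc M f"
      by (rule ring_hom_poly_eqI[OF ring_hom_comp[OF trunc_hom ring_hom_comp[OF ring_hom_swap_vars trunc_hom]]
            trunc_hom])
        (auto simp: trunc_def swap_vars_simps transpose_def subst_poly_simps)
    finally show ?case using Suc.IH by simp
  qed simp
  moreover have "trunc 0 f = of_int (const_term f)"
  proof (rule ring_hom_poly_eqI[OF trunc_hom])
    show "ring_hom (\<lambda>f. of_int (const_term f))"
      by (rule ring_homI) (simp_all add: const_term_simps)
  qed (auto simp: trunc_def)
  ultimately show ?thesis by simp
qed

text \<open>The uniqueness principle for Monk's rule, \<open>sch_adj\<close> and
  \<open>nabla_sch\<close>: divided differences shorten permutations, so the last hypothesis can
  come from an induction on length.\<close>

lemma poly_eq_by_divided_differences: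
  assumes "drop_var0 f = f" "drop_var0 g = g" "const_term f = const_term g"
    and "\<And>i. 1 \<le> i \<Longrightarrow> divided_difference i f = divided_difference i g"
  shows "f = g"
proof -
  have "f - g = of_int (const_term (f - g))"
    by (rule symmetric_imp_constant) (use assms in \<open>auto simp: drop_var0_simps divided_difference_diff\<close>)
  then show ?thesis using assms(3) by (simp add: const_term_simps)
qed

text \<open>The unused variable \<open>X 0\<close> serves as the scaling parameter.\<close>

definition scale_vars :: "poly_ring \<Rightarrow> poly_ring" where
  "scale_vars = subst_poly (\<lambda>j. if j = 0 then 0 else X 0 * X j)"

text \<open>Homogeneity as an identity of substitutions, so that closure properties follow from
  homomorphism laws without counting exponents. The first conjunct keeps the scaling parameter apart
  from the variables; 0 is homogeneous of every degree.\<close>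

definition homogeneous :: "nat \<Rightarrow> poly_ring \<Rightarrow> bool" where
  "homogeneous d f \<longleftrightarrow> drop_var0 f = f \<and> scale_vars f = X 0 ^ d * f"

lemma ring_hom_scale_vars: "ring_hom scale_vars"
  unfolding scale_vars_def by (rule ring_hom_subst_poly)

lemmas scale_vars_simps = ring_hom_simps[OF ring_hom_scale_vars]

lemma scale_vars_X: "scale_vars (X j) = (if j = 0 then 0 else X 0 * X j)"
  by (simp add: scale_vars_def)

lemma X_neq_0 [simp]: "X i \<noteq> 0"
  by (simp add: X_def)

lemma swap_vars_scale_vars:
  assumes "1 \<le> i"
  shows "scale_vars (swap_vars i f) = swap_vars i (scale_vars f)"
  by (rule ring_hom_poly_eqI[OF ring_hom_comp[OF ring_hom_scale_vars ring_hom_swap_vars]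
        ring_hom_comp[OF ring_hom_swap_vars ring_hom_scale_vars]])
    (use assms in \<open>auto simp: scale_vars_X swap_vars_simps transpose_def\<close>)

lemma homogeneous_mult: "homogeneous d f \<Longrightarrow> homogeneous e g \<Longrightarrow> homogeneous (d + e) (f * g)"
  by (simp add: homogeneous_def drop_var0_simps scale_vars_simps power_add mult_ac)

lemma homogeneous_1: "homogeneous 0 1"
  by (simp add: homogeneous_def drop_var0_simps scale_vars_simps)

lemma homogeneous_X: "1 \<le> i \<Longrightarrow> homogeneous 1 (X i)"
  by (simp add: homogeneous_def drop_var0_X scale_vars_X)

lemma homogeneous_power: "homogeneous d f \<Longrightarrow> homogeneous (k * d) (f ^ k)"
  by (induction k) (auto intro: homogeneous_1 homogeneous_mult)

lemma homogeneous_prod: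
  "(\<And>i. i \<in> A \<Longrightarrow> homogeneous (d i) (f i)) \<Longrightarrow> homogeneous (sum d A) (prod f A)"
  by (induction A rule: infinite_finite_induct) (auto intro: homogeneous_1 homogeneous_mult)

text \<open>Scaling multiplies the denominator by \<open>X 0\<close>, which lowers the degree by
  one. In degree 0 the truncated \<open>d - 1\<close> is still correct, because the quotient
  vanishes.\<close>

lemma homogeneous_divided_difference:
  assumes f: "homogeneous d f" and i: "1 \<le> i"
  shows "homogeneous (d - 1) (divided_difference i f)"
    and "d = 0 \<Longrightarrow> divided_difference i f = 0"
proof -
  let ?g = "divided_difference i f"
  have "scale_vars ?g * X 0 * (X i - X (Suc i)) = scale_vars (?g * (X i - X (Suc i)))"
    using i by (simp add: scale_vars_simps scale_vars_X algebra_simps)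
  also have "\<dots> = X 0 ^ d * f - swap_vars i (X 0 ^ d * f)"
    using f i by (simp add: divided_difference_eq scale_vars_simps swap_vars_scale_vars homogeneous_def)
  also have "\<dots> = X 0 ^ d * (f - swap_vars i f)"
    using i by (simp add: swap_vars_simps transpose_def algebra_simps)
  also have "\<dots> = X 0 ^ d * (?g * (X i - X (Suc i)))"
    by (simp only: divided_difference_eq)
  finally have "(scale_vars ?g * X 0) * (X i - X (Suc i)) = (X 0 ^ d * ?g) * (X i - X (Suc i))"
    by (simp add: mult_ac)
  then have eq: "scale_vars ?g * X 0 = X 0 ^ d * ?g"
    by (rule mult_right_cancel[THEN iffD1, rotated]) (use X_diff_neq_0 in simp)
  show d0: "?g = 0" if "d = 0"
  proof -
    \<comment> \<open>\<open>scale_vars\<close> sends \<open>X 0\<close> to 0; applied to this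
      equation it gives \<open>scale_vars ?g = 0\<close>, hence \<open>?g = 0\<close>.\<close>
    have g: "?g = scale_vars ?g * X 0" using eq that by simp
    have "scale_vars ?g = 0"
      by (subst g) (simp add: scale_vars_simps scale_vars_X)
    then show ?thesis using g by simp
  qed
  have "drop_var0 ?g = ?g" using f i by (simp add: drop_var0_divided_difference homogeneous_def)
  moreover have "scale_vars ?g = X 0 ^ (d - 1) * ?g"
  proof (cases d)
    case 0
    then show ?thesis using d0 by (simp add: scale_vars_simps)
  next
    case (Suc e)
    then have "scale_vars ?g * X 0 = (X 0 ^ e * ?g) * X 0" using eq by (simp add: mult_ac)
    then show ?thesis using Suc by simp
  qed
  ultimately show "homogeneous (d - 1) ?g" by (simp add: homogeneous_def)
qed

lemma const_term_homogeneous: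
  assumes "homogeneous d f" "0 < d"
  shows "const_term f = 0"
proof -
  have "const_term (scale_vars f) = const_term f"
    by (rule ring_hom_poly_eqI[OF ring_hom_comp[OF ring_hom_const_term ring_hom_scale_vars]
          ring_hom_const_term])
      (auto simp: scale_vars_X const_term_simps)
  moreover have "const_term (X 0 ^ d * f) = 0"
    using assms(2) by (simp add: const_term_simps)
  ultimately show ?thesis using assms(1) by (simp add: homogeneous_def)
qed

lemma schubert_homogeneous:
  assumes "w permutes {1..n}"
  shows "\<exists>d. homogeneous d (schubert n w)"
  using assms
proof (induction "card (noninversions n w)" arbitrary: w rule: less_induct)
  case less
  show ?case
  proof (cases "w = longest_perm n")
    case True
    have "homogeneous (\<Sum>i\<in>{1..n}. (n - i) * 1) (schubert n w)"
      unfolding True schubert_longest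
      by (intro homogeneous_prod homogeneous_power homogeneous_X) simp
    then show ?thesis by blast
  next
    case False
    obtain i where i: "1 \<le> i" "i < n" "w i < w (Suc i)"
      using ascent_exists[OF less.prems False] by blast
    have "\<exists>d. homogeneous d (schubert n (w \<circ> adj i))"
      by (rule less.hyps)
        (use i less.prems in \<open>auto intro!: card_noninversions_decreases permutes_comp_adj\<close>)
    then show ?thesis
      using schubert_ascent[OF less.prems i] homogeneous_divided_difference(1) i(1) by metis
  qed
qed

lemma sch_homogeneous: "fin_perm w \<Longrightarrow> \<exists>d. homogeneous d (sch w)"
  using schubert_homogeneous sch_eq by (metis fin_perm_def)

lemma drop_var0_sch: "fin_perm w \<Longrightarrow> drop_var0 (sch w) = sch w"
  using sch_homogeneous by (auto simp: homogeneous_def)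

text \<open>Divided differences along descents lead from \<open>sch w\<close> down to 1, and they
  would map 0 to 0.\<close>

lemma sch_nonzero: "fin_perm w \<Longrightarrow> sch w \<noteq> 0"
proof (induction rule: fin_perm_induct)
  case (descent w i)
  then show ?case by (metis divided_difference_0 divided_difference_sch_descent)
qed (unfold sch_id, simp)

text \<open>For \<open>w\<close> other than the identity some divided difference of
  \<open>sch w\<close> is nonzero, which forces positive degree.\<close>

lemma const_term_sch: 
  assumes w: "fin_perm w"
  shows "const_term (sch w) = (if w = id then 1 else 0)"
proof (cases "w = id")
  case False
  obtain d where d: "homogeneous d (sch w)" using sch_homogeneous[OF w] by blast
  obtain i where i: "1 \<le> i" "w (Suc i) < w i"
    using fin_perm_no_descent[OF w] fin_perm_ascent_or_descent[OF w] False by blast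
  have "sch (w \<circ> adj i) \<noteq> 0"
    by (rule sch_nonzero) (use w i in \<open>auto intro!: fin_perm_comp_transpose\<close>)
  then have "0 < d"
    using homogeneous_divided_difference(2)[OF d i(1)] divided_difference_sch_descent[OF w i] by auto
  then show ?thesis using const_term_homogeneous[OF d] False by simp
qed (simp add: sch_id const_term_simps)

text \<open>Linear independence in dual form. The functional takes the constant term after the
  divided differences along a chain of descents from \<open>w\<close> to the identity.\<close>

lemma sch_dual_functional:
  assumes "fin_perm w"
  shows "\<exists>\<eta> :: poly_ring \<Rightarrow> int. (\<forall>f g. \<eta> (f + g) = \<eta> f + \<eta> g) \<and>
    (\<forall>v. fin_perm v \<longrightarrow> \<eta> (sch v) = (if v = w then 1 else 0))"
  using assms
proof (induction rule: fin_perm_induct)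
  case id
  show ?case
    by (rule exI[of _ const_term]) (auto simp: const_term_simps const_term_sch)
next
  case (descent w i)
  then obtain \<eta> :: "poly_ring \<Rightarrow> int" where add: "\<And>f g. \<eta> (f + g) = \<eta> f + \<eta> g"
    and dual: "\<And>v. fin_perm v \<Longrightarrow> \<eta> (sch v) = (if v = w \<circ> adj i then 1 else 0)" by blast
  have [simp]: "\<eta> 0 = 0" using add[of 0 0] by simp
  have "\<eta> (divided_difference i (sch v)) = (if v = w then 1 else 0)" if v: "fin_perm v" for v
  proof -
    have "v \<circ> adj i = w \<circ> adj i \<longleftrightarrow> v = w"
      by (metis comp_assoc comp_id transpose_comp_involutory)
    moreover have "fin_perm (v \<circ> adj i)"
      using v descent by (intro fin_perm_comp_transpose) auto
    ultimately show ?thesis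
      using v descent dual[of "v \<circ> adj i"] by (auto simp: divided_difference_sch)
  qed
  then show ?case
    by (intro exI[of _ "\<lambda>f. \<eta> (divided_difference i f)"]) (auto simp: divided_difference_add add)
qed

subsection \<open>Monk's rule\<close>

text \<open>Says that \<open>v \<circ> transpose a b\<close>, with \<open>a < b\<close>, covers
  \<open>v\<close> in Bruhat order: its length is larger by exactly one.\<close>

definition bruhat_cover :: "(nat \<Rightarrow> nat) \<Rightarrow> nat \<Rightarrow> nat \<Rightarrow> bool" where
  "bruhat_cover v a b \<longleftrightarrow> a < b \<and> v a < v b \<and> (\<forall>l. a < l \<longrightarrow> l < b \<longrightarrow> v a < v l \<longrightarrow> \<not> v l < v b)"

text \<open>Monk's rule for the single variable \<open>X k\<close>, whose terms are positive for
  partners to the right of \<open>k\<close> and negative for those to the left. Keeping the sign in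
  the term gives one sum over all \<open>b\<close>.\<close>

definition monk_term :: "nat \<Rightarrow> (nat \<Rightarrow> nat) \<Rightarrow> nat \<Rightarrow> poly_ring" where
  "monk_term k v b = (if bruhat_cover v k b then sch (v \<circ> transpose k b)
     else if bruhat_cover v b k then - sch (v \<circ> transpose k b) else 0)"

text \<open>Relabelling positions by \<open>adj i\<close> adds or removes at most one position
  between \<open>a\<close> and \<open>b\<close>. If one is added, its cover condition is exactly the
  surviving descent at \<open>i\<close>; if one is removed, its condition and the surviving descent
  both follow from \<open>desc\<close> and \<open>v a < v b\<close>.\<close>

lemma bruhat_cover_descent:
  assumes v: "fin_perm v" and desc: "v (Suc i) < v i" and ab: "a < b" "\<not> (a = i \<and> b = Suc i)"
  shows "bruhat_cover v a b \<and> (v \<circ> transpose a b) (Suc i) < (v \<circ> transpose a b) i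
    \<longleftrightarrow> bruhat_cover (v \<circ> adj i) (adj i a) (adj i b)"
proof -
  have inj: "v x = v y \<longleftrightarrow> x = y" for x y by (rule fin_perm_inj[OF v])
  have reparam: "(\<forall>l. P l) \<longleftrightarrow> (\<forall>l. P (adj i l))" for P by (metis transpose_involutory)
  have "adj i a < adj i b" using ab by (auto simp: transpose_def)
  then have cov: "bruhat_cover (v \<circ> adj i) (adj i a) (adj i b) \<longleftrightarrow> v a < v b \<and>
     (\<forall>l. adj i a < adj i l \<and> adj i l < adj i b \<longrightarrow> \<not> (v a < v l \<and> v l < v b))"
    unfolding bruhat_cover_def by (subst reparam) auto
  have cov0: "bruhat_cover v a b \<longleftrightarrow> v a < v b \<and>
     (\<forall>l. a < l \<and> l < b \<longrightarrow> \<not> (v a < v l \<and> v l < v b))"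
    unfolding bruhat_cover_def using ab by auto
  consider "a = i" "Suc i < b" | "a = Suc i" "Suc i < b" | "a < i" "b = i" | "a < i" "b = Suc i"
    | "a \<noteq> i" "a \<noteq> Suc i" "b \<noteq> i" "b \<noteq> Suc i"
    using ab by linarith
  then show ?thesis
  proof cases
    case 1
    then have r: "adj i a < adj i l \<and> adj i l < adj i b \<longleftrightarrow> Suc i < l \<and> l < b" for l
      by (auto simp: transpose_def)
    have "a < l \<and> l < b \<longleftrightarrow> l = Suc i \<or> Suc i < l \<and> l < b" for l using 1 by auto
    moreover have "(v \<circ> transpose a b) (Suc i) < (v \<circ> transpose a b) i \<longleftrightarrow> v (Suc i) < v b"
      using 1 by (simp add: transpose_def)
    ultimately show ?thesis
      unfolding cov cov0 r using 1 desc by auto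
  next
    case 2
    then have r: "adj i a < adj i l \<and> adj i l < adj i b \<longleftrightarrow> l = i \<or> a < l \<and> l < b" for l
      by (auto simp: transpose_def)
    have "(v \<circ> transpose a b) (Suc i) < (v \<circ> transpose a b) i \<longleftrightarrow> v b < v i"
      using 2 by (simp add: transpose_def)
    moreover have "v b < v i \<longleftrightarrow> \<not> v i < v b" using inj[of b i] 2 by auto
    ultimately show ?thesis
      unfolding cov cov0 r using 2 desc by auto
  next
    case 3
    then have r: "adj i a < adj i l \<and> adj i l < adj i b \<longleftrightarrow> l = Suc i \<or> a < l \<and> l < b" for l
      by (auto simp: transpose_def)
    have "(v \<circ> transpose a b) (Suc i) < (v \<circ> transpose a b) i \<longleftrightarrow> v (Suc i) < v a"
      using 3 by (simp add: transpose_def)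
    moreover have "v (Suc i) < v a \<longleftrightarrow> \<not> v a < v (Suc i)" using inj[of a "Suc i"] 3 by auto
    ultimately show ?thesis
      unfolding cov cov0 r using 3 desc by auto
  next
    case 4
    then have r: "adj i a < adj i l \<and> adj i l < adj i b \<longleftrightarrow> a < l \<and> l < i" for l
      by (auto simp: transpose_def)
    have "a < l \<and> l < b \<longleftrightarrow> l = i \<or> a < l \<and> l < i" for l using 4 by auto
    moreover have "(v \<circ> transpose a b) (Suc i) < (v \<circ> transpose a b) i \<longleftrightarrow> v a < v i"
      using 4 by (simp add: transpose_def)
    ultimately show ?thesis
      unfolding cov cov0 r using 4 desc by auto
  next
    case 5
    then have r: "adj i a < adj i l \<and> adj i l < adj i b \<longleftrightarrow> a < l \<and> l < b" for l
      by (auto simp: transpose_def)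
    have "(v \<circ> transpose a b) (Suc i) < (v \<circ> transpose a b) i"
      using 5 desc by (simp add: transpose_def)
    then show ?thesis
      unfolding cov cov0 r by simp
  qed
qed

text \<open>Any other transposition creating a descent at \<open>i\<close> would have an entry at
  \<open>i\<close> or \<open>Suc i\<close> that violates the cover condition.\<close>

lemma bruhat_cover_ascent:
  assumes v: "fin_perm v" and asc: "v i < v (Suc i)" and ab: "bruhat_cover v a b"
    and desc: "(v \<circ> transpose a b) (Suc i) < (v \<circ> transpose a b) i"
  shows "a = i \<and> b = Suc i"
proof -
  have inj: "v x = v y \<longleftrightarrow> x = y" for x y by (rule fin_perm_inj[OF v])
  have "a < b" using ab by (simp add: bruhat_cover_def)
  then consider "a = i" "b = Suc i" | "a = i" "Suc i < b" | "a = Suc i" "Suc i < b" | "a < i" "b = i"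
    | "a < i" "b = Suc i" | "a \<noteq> i" "a \<noteq> Suc i" "b \<noteq> i" "b \<noteq> Suc i"
    by linarith
  then show ?thesis
    by cases (use ab asc desc in \<open>auto simp: bruhat_cover_def transpose_def\<close>)
qed

text \<open>Terms for \<open>v\<close> go to terms for \<open>v \<circ> adj i\<close>, with a
  correction only if the transposition is \<open>adj i\<close> itself. Summed over \<open>b\<close>,
  the corrections give the Leibniz summand
  \<open>divided_difference i (X k) * sch v\<close>.\<close>

lemma divided_difference_monk_term:
  assumes v: "fin_perm v" and i: "1 \<le> i" and kb: "1 \<le> k" "1 \<le> b"
  shows "divided_difference i (monk_term k v b) =
    (if v (Suc i) < v i then monk_term (adj i k) (v \<circ> adj i) (adj i b) else 0)
    + (if k = i \<and> b = Suc i then sch v else if k = Suc i \<and> b = i then - sch v else 0)"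
proof -
  have vt: "fin_perm (v \<circ> transpose k b)" using v kb by (intro fin_perm_comp_transpose)
  have dd: "divided_difference i (monk_term k v b) =
      (if (v \<circ> transpose k b) (Suc i) < (v \<circ> transpose k b) i then
       if bruhat_cover v k b then sch (v \<circ> transpose k b \<circ> adj i)
       else if bruhat_cover v b k then - sch (v \<circ> transpose k b \<circ> adj i) else 0 else 0)"
    by (simp add: monk_term_def divided_difference_uminus divided_difference_sch[OF vt i])
  have comp: "v \<circ> adj i \<circ> transpose (adj i k) (adj i b) = v \<circ> transpose k b \<circ> adj i"
    by (auto simp: fun_eq_iff transpose_def)
  have not_both: "\<not> (bruhat_cover u x y \<and> bruhat_cover u y x)" for u x y
    by (auto simp: bruhat_cover_def)
  show ?thesis
  proof (cases "v (Suc i) < v i")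
    case desc: True
    have no_cover: "\<not> bruhat_cover v i (Suc i)" using desc by (simp add: bruhat_cover_def)
    have cover': "bruhat_cover (v \<circ> adj i) i (Suc i)" using desc by (simp add: bruhat_cover_def)
    have not_cover': "\<not> bruhat_cover (v \<circ> adj i) (Suc i) i" by (simp add: bruhat_cover_def)
    have not_cover: "\<not> bruhat_cover v (Suc i) i" by (simp add: bruhat_cover_def)
    have sq: "v \<circ> adj i \<circ> transpose (Suc i) i = v" by (auto simp: fun_eq_iff transpose_def)
    consider "k = i" "b = Suc i" | "k = Suc i" "b = i"
      | "\<not> (k = i \<and> b = Suc i)" "\<not> (k = Suc i \<and> b = i)" by blast
    then show ?thesis
    proof cases
      case 1
      then show ?thesis
        using dd desc no_cover cover' not_cover' not_cover sq by (simp add: monk_term_def)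
    next
      case 2
      then show ?thesis
        using dd desc no_cover cover' not_cover' not_cover sq
        by (simp add: monk_term_def transpose_commute)
    next
      case 3
      show ?thesis
      proof (cases k b rule: linorder_cases)
        case less
        have "\<not> bruhat_cover v b k" "\<not> bruhat_cover (v \<circ> adj i) (adj i b) (adj i k)"
          using less 3 by (auto simp: bruhat_cover_def transpose_def split: if_splits)
        then show ?thesis
          using bruhat_cover_descent[OF v desc less 3(1)] dd desc 3 comp
          by (auto simp: monk_term_def)
      next
        case greater
        have "\<not> bruhat_cover v k b" "\<not> bruhat_cover (v \<circ> adj i) (adj i k) (adj i b)"
          using greater 3 by (auto simp: bruhat_cover_def transpose_def split: if_splits)
        then show ?thesis
          using bruhat_cover_descent[OF v desc greater] dd desc 3 comp
          by (auto simp: monk_term_def transpose_commute[of k b])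
      next
        case equal
        then show ?thesis using dd 3 by (auto simp: monk_term_def bruhat_cover_def)
      qed
    qed
  next
    case False
    then have asc: "v i < v (Suc i)" using fin_perm_ascent_or_descent[OF v] by fastforce
    have cover: "bruhat_cover v i (Suc i)" "\<not> bruhat_cover v (Suc i) i"
      using asc by (auto simp: bruhat_cover_def)
    consider "k = i" "b = Suc i" | "k = Suc i" "b = i"
      | "\<not> (k = i \<and> b = Suc i)" "\<not> (k = Suc i \<and> b = i)" by blast
    then show ?thesis
    proof cases
      case 1
      then show ?thesis using dd False asc cover by (simp add: comp_assoc)
    next
      case 2
      then show ?thesis using dd False asc cover by (simp add: comp_assoc transpose_commute[of "Suc i" i])
    next
      case 3
      then show ?thesis
        using dd False bruhat_cover_ascent[OF v asc, of k b] bruhat_cover_ascent[OF v asc, of b k]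
        by (auto simp: transpose_commute[of k b])
    qed
  qed
qed

lemma not_id_comp_transpose_cover:
  assumes "bruhat_cover v a b"
  shows "v \<circ> transpose a b \<noteq> id"
proof
  assume "v \<circ> transpose a b = id"
  then have "(v \<circ> transpose a b) a < (v \<circ> transpose a b) b"
    using assms by (simp add: bruhat_cover_def)
  then show False using assms by (simp add: bruhat_cover_def)
qed

text \<open>By Leibniz each divided difference reduces the claim to \<open>v \<circ> adj i\<close>
  with \<open>k\<close> replaced by \<open>adj i k\<close>. Partners up to \<open>Suc n\<close>
  suffice: for a larger \<open>b\<close> the fixed point \<open>Suc n\<close> lies in between, in
  position and in value.\<close>

lemma monk_rule:
  assumes "fin_perm v" "v permutes {1..n}" "1 \<le> k" "k \<le> n"
  shows "X k * sch v = (\<Sum>b\<in>{1..Suc n}. monk_term k v b)"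
  using assms
proof (induction arbitrary: k rule: fin_perm_descent_induct)
  case (step v)
  have v: "fin_perm v" by fact
  show ?case
  proof (rule poly_eq_by_divided_differences)
    show "drop_var0 (X k * sch v) = X k * sch v"
      using step.prems drop_var0_sch[OF v] by (simp add: drop_var0_simps drop_var0_X)
    have "drop_var0 (monk_term k v b) = monk_term k v b" if "1 \<le> b" for b
      using that step.prems drop_var0_sch[OF fin_perm_comp_transpose[OF v, of k b]]
      by (simp add: monk_term_def drop_var0_simps)
    then show "drop_var0 (\<Sum>b\<in>{1..Suc n}. monk_term k v b) = (\<Sum>b\<in>{1..Suc n}. monk_term k v b)"
      by (simp add: drop_var0_simps)
    have "const_term (monk_term k v b) = 0" if "1 \<le> b" for b
      using that step.prems const_term_sch[OF fin_perm_comp_transpose[OF v, of k b]]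
        not_id_comp_transpose_cover[of v k b] not_id_comp_transpose_cover[of v b k]
      by (simp add: monk_term_def const_term_simps transpose_commute[of b k])
    then show "const_term (X k * sch v) = const_term (\<Sum>b\<in>{1..Suc n}. monk_term k v b)"
      by (simp add: const_term_simps)
    fix i :: nat assume i: "1 \<le> i"
    let ?corr = "\<lambda>b. if k = i \<and> b = Suc i then sch v else if k = Suc i \<and> b = i then - sch v else 0"
    have corr: "(\<Sum>b\<in>{1..Suc n}. ?corr b) = divided_difference i (X k) * sch v"
    proof -
      have "(\<Sum>b\<in>{1..Suc n}. ?corr b) = (\<Sum>b\<in>{1..Suc n}. (if b = Suc i then if k = i then sch v else 0 else 0)
          + (if b = i then if k = Suc i then - sch v else 0 else 0))"
        by (rule sum.cong) auto
      also have "\<dots> = (if k = i then sch v else 0) + (if k = Suc i then - sch v else 0)"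
        using i step.prems by (simp add: sum.distrib)
      finally show ?thesis by (simp add: divided_difference_X)
    qed
    have rhs: "divided_difference i (\<Sum>b\<in>{1..Suc n}. monk_term k v b) =
      (\<Sum>b\<in>{1..Suc n}. if v (Suc i) < v i then monk_term (adj i k) (v \<circ> adj i) (adj i b) else 0)
      + divided_difference i (X k) * sch v"
      unfolding divided_difference_sum corr[symmetric] sum.distrib[symmetric]
      by (rule sum.cong) (use divided_difference_monk_term[OF v i step.prems(2)] in auto)
    show "divided_difference i (X k * sch v) = divided_difference i (\<Sum>b\<in>{1..Suc n}. monk_term k v b)"
    proof (cases "v (Suc i) < v i")
      case True
      \<comment> \<open>This keeps \<open>n\<close> valid for the shorter permutation and lets
        \<open>adj i\<close> reindex the sum over \<open>b\<close>.\<close>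
      have "i < n" using descent_in_range[OF step.prems(1) i True] .
      then have "adj i permutes {1..Suc n}" using i by (auto intro!: permutes_swap_id)
      then have "(\<Sum>b\<in>{1..Suc n}. monk_term (adj i k) (v \<circ> adj i) (adj i b))
        = (\<Sum>b\<in>{1..Suc n}. monk_term (adj i k) (v \<circ> adj i) b)"
        by (intro sum.reindex_bij_betw permutes_imp_bij)
      also have "\<dots> = X (adj i k) * sch (v \<circ> adj i)"
      proof (rule step.IH[symmetric])
        show "(v \<circ> adj i) permutes {1..n}" using permutes_comp_adj step.prems(1) i \<open>i < n\<close> .
        show "1 \<le> adj i k" "adj i k \<le> n" using i \<open>i < n\<close> step.prems by (auto simp: transpose_def)
      qed (use i True in auto)
      finally show ?thesis
        unfolding rhs using True i v
        by (simp add: divided_difference_mult divided_difference_sch)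
    next
      case False
      then show ?thesis
        unfolding rhs using i v by (simp add: divided_difference_mult divided_difference_sch)
    qed
  qed
qed

lemma sum_singleton_support:
  assumes "finite A" "a \<in> A" "\<And>b. b \<in> A \<Longrightarrow> b \<noteq> a \<Longrightarrow> f b = 0"
  shows "sum f A = f a"
  using assms by (metis (no_types, lifting) DiffE insertI1 singletonD sum.remove add.right_neutral sum.neutral)

text \<open>Distinct \<open>b\<close> give distinct permutations, so terms of opposite sign cannot
  cancel; the functional dual to the term at \<open>a\<close> isolates it.\<close>

lemma monk_terms_independent:
  assumes v: "fin_perm v" and k: "1 \<le> k" and B: "finite B" "B \<subseteq> {1..}"
    and sum0: "(\<Sum>b\<in>B. monk_term k v b) = 0" and a: "a \<in> B"
  shows "\<not> bruhat_cover v k a \<and> \<not> bruhat_cover v a k"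
proof -
  have fp: "fin_perm (v \<circ> transpose k b)" if "b \<in> B" for b
    using v k B that by (intro fin_perm_comp_transpose) auto
  obtain \<eta> :: "poly_ring \<Rightarrow> int" where add: "\<And>f g. \<eta> (f + g) = \<eta> f + \<eta> g"
    and dual: "\<And>u. fin_perm u \<Longrightarrow> \<eta> (sch u) = (if u = v \<circ> transpose k a then 1 else 0)"
    using sch_dual_functional[OF fp[OF a]] by blast
  have \<eta>0: "\<eta> 0 = 0" using add[of 0 0] by simp
  have \<eta>_uminus: "\<eta> (- f) = - \<eta> f" for f using add[of f "- f"] \<eta>0 by simp
  have \<eta>_sum: "\<eta> (\<Sum>b\<in>C. f b) = (\<Sum>b\<in>C. \<eta> (f b))" for f :: "nat \<Rightarrow> poly_ring" and C
    by (induction C rule: infinite_finite_induct) (auto simp: \<eta>0 add)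
  have "\<eta> (monk_term k v b) = 0" if b: "b \<in> B" "b \<noteq> a" for b
  proof -
    have "v \<circ> transpose k b \<noteq> v \<circ> transpose k a"
    proof
      assume "v \<circ> transpose k b = v \<circ> transpose k a"
      then have "(v \<circ> transpose k b) k = (v \<circ> transpose k a) k" by simp
      then show False using b fin_perm_inj[OF v] by simp
    qed
    then show ?thesis
      using dual[OF fp[OF b(1)]] by (simp add: monk_term_def \<eta>0 \<eta>_uminus)
  qed
  then have "\<eta> (\<Sum>b\<in>B. monk_term k v b) = \<eta> (monk_term k v a)"
    unfolding \<eta>_sum by (intro sum_singleton_support B a)
  then have "\<eta> (monk_term k v a) = 0" using sum0 \<eta>0 by simp
  then show ?thesis
    using dual[OF fp[OF a]] by (auto simp: monk_term_def \<eta>_uminus split: if_splits)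
qed

text \<open>The bound \<open>1 \<le> j\<close> excludes position 0, whose entry 0 lies below all
  others. Positions \<open>k\<close> are unbounded because the partner \<open>u\<close> may move
  letters beyond \<open>n\<close>.\<close>

definition good_descent :: "(nat \<Rightarrow> nat) \<Rightarrow> nat \<Rightarrow> bool" where
  "good_descent w i \<longleftrightarrow> w (Suc i) < w i \<and> (\<forall>j. 1 \<le> j \<longrightarrow> j < i \<longrightarrow> w (Suc i) < w j)
     \<and> (\<forall>k. Suc i < k \<longrightarrow> \<not> (w (Suc i) < w k \<and> w k < w i))"

lemma monk_rule_descent:
  assumes w: "fin_perm w" and i: "1 \<le> i" and desc: "w (Suc i) < w i"
  obtains n where "w permutes {1..n}" "Suc i \<le> n" 
    "X i * sch (w \<circ> adj i) = sch w + (\<Sum>b\<in>{1..Suc n} - {Suc i}. monk_term i (w \<circ> adj i) b)"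
proof -
  let ?v = "w \<circ> adj i"
  obtain n where n: "w permutes {1..n}" "Suc i \<le> n" by (rule fin_permE[OF w])
  have "X i * sch ?v = (\<Sum>b\<in>{1..Suc n}. monk_term i ?v b)"
    using i n w by (intro monk_rule permutes_comp_adj fin_perm_comp_transpose) auto
  also have "\<dots> = monk_term i ?v (Suc i) + (\<Sum>b\<in>{1..Suc n} - {Suc i}. monk_term i ?v b)"
    using n by (intro sum.remove) auto
  also have "monk_term i ?v (Suc i) = sch w"
    using desc by (simp add: monk_term_def bruhat_cover_def comp_assoc)
  finally show ?thesis using that n by blast
qed

text \<open>In \<open>w \<circ> adj i\<close> the position \<open>Suc i\<close> holds
  \<open>w i\<close> and blocks every cover from \<open>i\<close> to a larger entry further
  right.\<close>

lemma bruhat_cover_after_adj: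
  assumes w: "fin_perm w" and desc: "w (Suc i) < w i" and b: "b \<noteq> Suc i"
    and cover: "bruhat_cover (w \<circ> adj i) i b"
  shows "Suc i < b \<and> w (Suc i) < w b \<and> w b < w i"
proof -
  have "i < b" "w (Suc i) < w b"
    using cover b by (auto simp: bruhat_cover_def transpose_def split: if_splits)
  moreover have "\<not> w i < w b"
  proof
    assume "w i < w b"
    moreover have "(w \<circ> adj i) (Suc i) = w i" "(w \<circ> adj i) i = w (Suc i)" "(w \<circ> adj i) b = w b"
      using b \<open>i < b\<close> by (auto simp: transpose_def)
    ultimately show False
      using cover b \<open>i < b\<close> desc unfolding bruhat_cover_def by (metis Suc_lessI lessI)
  qed
  moreover have "w b \<noteq> w i" using \<open>i < b\<close> fin_perm_inj[OF w] by simp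
  ultimately show ?thesis using b by auto
qed

text \<open>In Monk's rule for \<open>X i * sch (w \<circ> adj i)\<close> the partner
  \<open>Suc i\<close> yields \<open>sch w\<close>. The second condition of
  \<open>good_descent\<close> excludes the negative terms, the third the remaining positive
  ones.\<close>

lemma good_descent_iff:
  assumes w: "fin_perm w" and i: "1 \<le> i" and desc: "w (Suc i) < w i"
  shows "sch w = X i * sch (w \<circ> adj i) \<longleftrightarrow> good_descent w i"
proof -
  let ?v = "w \<circ> adj i"
  obtain n where n: "w permutes {1..n}" "Suc i \<le> n" and
    monk: "X i * sch ?v = sch w + (\<Sum>b\<in>{1..Suc n} - {Suc i}. monk_term i ?v b)"
    by (rule monk_rule_descent[OF w i desc])
  have v: "fin_perm ?v" using w i by (intro fin_perm_comp_transpose) auto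
  show ?thesis
  proof
    assume "good_descent w i"
    have "monk_term i ?v b = 0" if b: "b \<in> {1..Suc n} - {Suc i}" for b
    proof -
      have "\<not> bruhat_cover ?v i b"
        using bruhat_cover_after_adj[OF w desc, of b] b \<open>good_descent w i\<close>
        by (auto simp: good_descent_def)
      moreover have "\<not> bruhat_cover ?v b i"
      proof
        assume "bruhat_cover ?v b i"
        then have "b < i" "w b < w (Suc i)" by (auto simp: bruhat_cover_def transpose_def)
        moreover have "w (Suc i) < w b"
          using \<open>good_descent w i\<close> \<open>b < i\<close> b by (auto simp: good_descent_def)
        ultimately show False by simp
      qed
      ultimately show ?thesis by (simp add: monk_term_def)
    qed
    then show "sch w = X i * sch ?v" using monk by simp
  next
    assume "sch w = X i * sch ?v"
    then have "(\<Sum>b\<in>{1..Suc n} - {Suc i}. monk_term i ?v b) = 0" using monk by simp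
    then have no_cover: "\<not> bruhat_cover ?v i b \<and> \<not> bruhat_cover ?v b i"
      if "b \<in> {1..Suc n} - {Suc i}" for b
      by (rule monk_terms_independent[OF v i, rotated 2]) (use that in auto)
    have "w (Suc i) < w j" if j: "1 \<le> j" "j < i" for j
    proof (rule ccontr)
      assume "\<not> w (Suc i) < w j"
      then have "w j < w (Suc i)" using j fin_perm_inj[OF w, of j "Suc i"] by simp
      \<comment> \<open>The rightmost smaller entry before \<open>i\<close> has no obstruction on
        the way to \<open>i\<close>, so it gives a negative term.\<close>
      define a where "a = (GREATEST a. 1 \<le> a \<and> a < i \<and> w a < w (Suc i))"
      have a: "1 \<le> a \<and> a < i \<and> w a < w (Suc i)"
        unfolding a_def by (rule GreatestI_nat[of _ j i]) (use j \<open>w j < w (Suc i)\<close> in auto)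
      have "\<not> w l < w (Suc i)" if "a < l" "l < i" for l
        using Greatest_le_nat[of "\<lambda>a. 1 \<le> a \<and> a < i \<and> w a < w (Suc i)" l i] that a
        by (fold a_def) auto
      then have "bruhat_cover ?v a i"
        using a by (auto simp: bruhat_cover_def transpose_def)
      then show False using no_cover[of a] a n by auto
    qed
    moreover have "\<not> (w (Suc i) < w k \<and> w k < w i)" if k: "Suc i < k" for k
    proof
      assume between: "w (Suc i) < w k \<and> w k < w i"
      \<comment> \<open>Likewise the first intermediate value after \<open>Suc i\<close> gives a
        positive term.\<close>
      define b where "b = (LEAST b. Suc i < b \<and> w (Suc i) < w b \<and> w b < w i)"
      have b: "Suc i < b \<and> w (Suc i) < w b \<and> w b < w i"
        unfolding b_def by (rule LeastI[of _ k]) (use k between in auto)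
      have min: "\<not> (w (Suc i) < w l \<and> w l < w i)" if "Suc i < l" "l < b" for l
        using not_less_Least[of l "\<lambda>b. Suc i < b \<and> w (Suc i) < w b \<and> w b < w i"] that
        by (fold b_def) auto
      have "bruhat_cover ?v i b"
        unfolding bruhat_cover_def
      proof (intro conjI allI impI)
        fix l assume "i < l" "l < b" "?v i < ?v l"
        then show "\<not> ?v l < ?v b"
          using b min[of l] by (cases "l = Suc i") (auto simp: transpose_def)
      qed (use b in \<open>auto simp: transpose_def\<close>)
      moreover have "b \<le> n"
        using b permutes_not_in[OF n(1), of b] descent_in_range[OF n(1) i desc]
          permutes_in_image[OF n(1), of i] i by auto
      ultimately show False using no_cover[of b] b by auto
    qed
    ultimately show "good_descent w i" using desc by (auto simp: good_descent_def)
  qed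
qed

subsection \<open>Positivity of Schubert polynomials at the all-ones point\<close>

text \<open>The sum of all partial derivatives, as the linear coefficient in \<open>t\<close> of \<open>f(x + t)\<close>.\<close>

definition nabla :: "poly_ring \<Rightarrow> poly_ring" where
  "nabla f = coeff (subst_poly (\<lambda>i. [:X i, if i = 0 then 0 else 1:]) f) 1"

lemma nabla_add: "nabla (f + g) = nabla f + nabla g"
  by (simp add: nabla_def subst_poly_simps)

lemma nabla_of_int [simp]: "nabla (of_int c) = 0"
  by (simp add: nabla_def subst_poly_simps of_int_poly One_nat_def)

lemma nabla_X: "nabla (X i) = (if i = 0 then 0 else 1)"
  by (simp add: nabla_def One_nat_def)

lemma nabla_mult: "nabla (f * g) = nabla f * g + f * nabla g"
proof -
  let ?h = "subst_poly (\<lambda>i. [:X i, if i = 0 then 0 else 1:])"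
  have "ring_hom (\<lambda>f. coeff (?h f) 0)"
    by (rule ring_homI) (simp_all add: subst_poly_simps coeff_mult)
  then have "coeff (?h f) 0 = f" for f
    by (rule ring_hom_poly_eqI[where h = "\<lambda>f. f"]) (auto simp: ring_hom_def)
  moreover have "{..1::nat} = {0, 1}" by auto
  ultimately show ?thesis by (simp add: nabla_def subst_poly_simps coeff_mult)
qed

lemma nabla_diff: "nabla (f - g) = nabla f - nabla g"
  by (simp add: nabla_def subst_poly_simps)

lemma nabla_sum: "nabla (sum f A) = (\<Sum>a\<in>A. nabla (f a))"
  by (simp add: nabla_def subst_poly_simps coeff_sum)

lemma nabla_swap_vars: "1 \<le> i \<Longrightarrow> nabla (swap_vars i f) = swap_vars i (nabla f)"
  by (induction f rule: poly_ring_induct)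
    (auto simp: nabla_add nabla_mult nabla_X swap_vars_simps transpose_def)

text \<open>Translating all variables of positive index together leaves
  \<open>X i - X (Suc i)\<close> unchanged, so \<open>nabla\<close> kills the denominator.\<close>

lemma nabla_divided_difference:
  assumes "1 \<le> i"
  shows "nabla (divided_difference i f) = divided_difference i (nabla f)"
proof -
  have "nabla (divided_difference i f) * (X i - X (Suc i)) = nabla f - swap_vars i (nabla f)"
    using arg_cong[OF divided_difference_eq[of i f], of nabla] assms
    by (simp add: nabla_mult nabla_diff nabla_X nabla_swap_vars)
  then show ?thesis by (rule divided_difference_eqI'[symmetric])
qed

lemma drop_var0_nabla: "drop_var0 (nabla f) = nabla (drop_var0 f)"
  using nabla_of_int[of 0] by (induction f rule: poly_ring_induct)
    (auto simp: nabla_add nabla_mult nabla_X drop_var0_X drop_var0_simps)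

lemma homogeneous_nabla:
  assumes "homogeneous (Suc d) f"
  shows "homogeneous d (nabla f)"
proof -
  have "nabla (scale_vars f) = X 0 * scale_vars (nabla f)"
    using nabla_of_int[of 0] by (induction f rule: poly_ring_induct)
      (auto simp: nabla_add nabla_mult nabla_X scale_vars_X scale_vars_simps algebra_simps)
  moreover have "nabla (X 0 ^ k) = 0" for k
    using nabla_of_int[of 1] by (induction k) (auto simp: nabla_mult nabla_X)
  ultimately have "X 0 * scale_vars (nabla f) = X 0 * (X 0 ^ d * nabla f)"
    using assms by (simp add: homogeneous_def nabla_mult del: power_Suc, simp)
  then have "scale_vars (nabla f) = X 0 ^ d * nabla f" by simp
  then show ?thesis using assms by (simp add: homogeneous_def drop_var0_nabla)
qed

lemma adj_less_iff:
  "\<not> (a = i \<and> b = Suc i) \<Longrightarrow> \<not> (a = Suc i \<and> b = i) \<Longrightarrow> adj i a < adj i b \<longleftrightarrow> a < b"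
  by (auto simp: transpose_def)

lemma fin_perm_inv:
  assumes "fin_perm w"
  shows "fin_perm (inv w)" "w (inv w k) = k" "inv w (w k) = k" "inv (inv w) = w"
proof -
  obtain n where n: "w permutes {1..n}" using assms by (auto simp: fin_perm_def)
  show "fin_perm (inv w)" using permutes_inv[OF n] by blast
  show "w (inv w k) = k" "inv w (w k) = k" using permutes_inverses[OF n] .
  show "inv (inv w) = w" using inv_inv_eq permutes_bij[OF n] by blast
qed

lemma inv_comp_adj: "fin_perm w \<Longrightarrow> inv (w \<circ> adj i) = adj i \<circ> inv w"
  by (rule inv_unique_comp) (simp_all add: fun_eq_iff fin_perm_inv)

text \<open>The divided differences of the sum telescope: only index \<open>r\<close> survives.
  Applying \<open>nabla\<close> then gives \<open>r\<close>, the origin of the weights in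
  \<open>nabla_sch\<close>.\<close>

lemma sch_adj:
  assumes "1 \<le> r"
  shows "sch (adj r) = (\<Sum>j\<in>{1..r}. X j)"
proof (rule poly_eq_by_divided_differences)
  have fp: "fin_perm (adj r)" using assms by (intro fin_perm_transpose) auto
  show "drop_var0 (sch (adj r)) = sch (adj r)" by (rule drop_var0_sch[OF fp])
  show "drop_var0 (\<Sum>j\<in>{1..r}. X j) = (\<Sum>j\<in>{1..r}. X j)"
    by (simp add: drop_var0_simps drop_var0_X)
  have "adj r r \<noteq> r" by simp
  then have "adj r \<noteq> id" by (metis id_apply)
  then show "const_term (sch (adj r)) = const_term (\<Sum>j\<in>{1..r}. X j)"
    by (simp add: const_term_sch[OF fp] const_term_simps)
  fix i :: nat assume i: "1 \<le> i"
  have "adj r (Suc i) < adj r i \<longleftrightarrow> i = r" by (auto simp: transpose_def)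
  then have "divided_difference i (sch (adj r)) = (if i = r then 1 else 0)"
    by (simp add: divided_difference_sch[OF fp i] sch_id)
  moreover have "divided_difference i (\<Sum>j\<in>{1..r}. X j)
    = (\<Sum>j\<in>{1..r}. (if j = i then 1 else 0) - (if j = Suc i then 1 else 0))"
    unfolding divided_difference_sum divided_difference_X by (rule sum.cong) auto
  moreover have "\<dots> = (if i = r then 1 else 0)"
    using i assms by (auto simp: sum_subtractf)
  ultimately show "divided_difference i (sch (adj r)) = divided_difference i (\<Sum>j\<in>{1..r}. X j)"
    by simp
qed

lemma nabla_sch_adj: "1 \<le> r \<Longrightarrow> nabla (sch (adj r)) = of_nat r"
  by (simp add: sch_adj nabla_sum nabla_X)

lemma adj_eq_iff: "adj i = adj r \<longleftrightarrow> i = r"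
proof
  assume eq: "adj i = adj r"
  have "adj i i = adj r i" "adj i (Suc i) = adj r (Suc i)" by (simp_all only: eq)
  then show "i = r" by (auto simp: transpose_def split: if_splits)
qed simp

text \<open>Apart from the identity, such a \<open>w\<close> admits two successive nonzero divided
  differences, so \<open>sch w\<close> has degree at least 2 and its derivative still has positive
  degree.\<close>

lemma const_term_nabla_sch:
  assumes w: "fin_perm w" and not_adj: "\<And>i. 1 \<le> i \<Longrightarrow> w \<noteq> adj i"
  shows "const_term (nabla (sch w)) = 0"
proof -
  obtain d where d: "homogeneous d (sch w)" using sch_homogeneous[OF w] by blast
  show ?thesis
  proof (cases "w = id")
    case True
    then show ?thesis
      using nabla_of_int[of 1] by (simp add: sch_id const_term_simps)
  next
    case not_id: False
    obtain i where i: "1 \<le> i" "w (Suc i) < w i"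
      using fin_perm_no_descent[OF w] fin_perm_ascent_or_descent[OF w] not_id by blast
    let ?v = "w \<circ> adj i"
    have v: "fin_perm ?v" using w i by (intro fin_perm_comp_transpose) auto
    have "?v \<noteq> id"
    proof
      assume "?v = id"
      then have "?v \<circ> adj i = adj i" by simp
      then show False using not_adj[OF i(1)] by (simp add: comp_assoc)
    qed
    then obtain j where j: "1 \<le> j" "?v (Suc j) < ?v j"
      using fin_perm_no_descent[OF v] fin_perm_ascent_or_descent[OF v] by blast
    have "sch (?v \<circ> adj j) \<noteq> 0"
      by (rule sch_nonzero) (use v j in \<open>auto intro!: fin_perm_comp_transpose\<close>)
    then have "divided_difference j (divided_difference i (sch w)) \<noteq> 0"
      by (simp only: divided_difference_sch_descent[OF w i] divided_difference_sch_descent[OF v j])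
        simp
    moreover have "homogeneous (d - 1) (divided_difference i (sch w))"
      by (rule homogeneous_divided_difference(1)[OF d i(1)])
    ultimately have "d - 1 \<noteq> 0" using homogeneous_divided_difference(2) j(1) by blast
    then obtain e where "d = Suc (Suc e)" by (metis One_nat_def diff_Suc_1 old.nat.exhaust diff_0_eq_0)
    then have "homogeneous (Suc e) (nabla (sch w))" using homogeneous_nabla d by blast
    then show ?thesis by (rule const_term_homogeneous) simp
  qed
qed

text \<open>The condition on \<open>inv w\<close> says that \<open>Suc i\<close> stands before
  \<open>i\<close> in \<open>w\<close>, a left descent, and \<open>adj i \<circ> w\<close> swaps
  these two values. Divided differences act on positions from the right, so they respect this
  expansion.\<close>

lemma nabla_sch:
  assumes "fin_perm w" "w permutes {1..n}"
  shows "nabla (sch w) =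
    (\<Sum>i\<in>{1..n}. if inv w (Suc i) < inv w i then of_nat i * sch (adj i \<circ> w) else 0)"
  using assms
proof (induction rule: fin_perm_descent_induct)
  case (step w)
  have w: "fin_perm w" by fact
  note inv_w = fin_perm_inv(2,3)[OF w]
  have fp: "fin_perm (adj i \<circ> w)" if "1 \<le> i" for i
    using w that by (intro fin_perm_comp fin_perm_transpose) auto
  show ?case
  proof (rule poly_eq_by_divided_differences)
    show "drop_var0 (nabla (sch w)) = nabla (sch w)"
      by (simp add: drop_var0_nabla drop_var0_sch[OF w])
    show "drop_var0 (\<Sum>i\<in>{1..n}. if inv w (Suc i) < inv w i then of_nat i * sch (adj i \<circ> w) else 0)
      = (\<Sum>i\<in>{1..n}. if inv w (Suc i) < inv w i then of_nat i * sch (adj i \<circ> w) else 0)"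
      unfolding drop_var0_simps
      by (rule sum.cong) (auto simp: drop_var0_simps drop_var0_sch fp)
    show "const_term (nabla (sch w)) =
      const_term (\<Sum>i\<in>{1..n}. if inv w (Suc i) < inv w i then of_nat i * sch (adj i \<circ> w) else 0)"
    proof -
      have is_adj: "adj i \<circ> w = id \<longleftrightarrow> w = adj i" for i
        by (metis comp_assoc comp_id id_comp transpose_comp_involutory)
      have "const_term (\<Sum>i\<in>{1..n}. if inv w (Suc i) < inv w i then of_nat i * sch (adj i \<circ> w) else 0)
        = (\<Sum>i\<in>{1..n}. if inv w (Suc i) < inv w i \<and> w = adj i then int i else 0)"
        unfolding const_term_simps
        by (rule sum.cong) (auto simp: const_term_simps const_term_sch fp is_adj sch_id)
      also have "\<dots> = const_term (nabla (sch w))"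
      proof (cases "\<exists>i\<ge>1. w = adj i")
        case True
        then obtain r where r: "1 \<le> r" "w = adj r" by blast
        then have "r < n" using descent_in_range[OF step.prems, of r] by simp
        have "inv w (Suc i) < inv w i \<and> w = adj i \<longleftrightarrow> i = r" for i
          using r adj_eq_iff[of r i] by auto
        then show ?thesis
          using r \<open>r < n\<close> by (simp add: nabla_sch_adj const_term_simps)
      next
        case False
        then have "(\<Sum>i\<in>{1..n}. if inv w (Suc i) < inv w i \<and> w = adj i then int i else 0) = 0"
          by (intro sum.neutral) auto
        then show ?thesis using False const_term_nabla_sch[OF w] by auto
      qed
      finally show ?thesis ..
    qed
    fix j :: nat assume j: "1 \<le> j"
    have inv_adj: "inv (w \<circ> adj j) = adj j \<circ> inv w" by (rule inv_comp_adj[OF w])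
    \<comment> \<open>Swapping values \<open>i\<close>, \<open>Suc i\<close> and swapping positions
      \<open>j\<close>, \<open>Suc j\<close> interfere only if these positions hold these values;
      then both sides are 0.\<close>
    have eq: "(if inv w (Suc i) < inv w i \<and> adj i (w (Suc j)) < adj i (w j)
        then of_nat i * sch (adj i \<circ> (w \<circ> adj j)) else 0) =
      (if w (Suc j) < w j \<and> inv (w \<circ> adj j) (Suc i) < inv (w \<circ> adj j) i
        then of_nat i * sch (adj i \<circ> (w \<circ> adj j)) else 0)" for i
    proof -
      have iff: "w a = b \<longleftrightarrow> a = inv w b" for a b
        using inv_w(1)[of b] inv_w(2)[of a] by auto
      consider "w j = i" "w (Suc j) = Suc i" | "w j = Suc i" "w (Suc j) = i"
        | "\<not> (w j = i \<and> w (Suc j) = Suc i)" "\<not> (w j = Suc i \<and> w (Suc j) = i)" by blast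
      then show ?thesis
      proof cases
        case 1
        then have "inv w i = j" "inv w (Suc i) = Suc j" by (simp_all add: iff)
        then show ?thesis using 1 inv_adj by simp
      next
        case 2
        then have "inv w i = Suc j" "inv w (Suc i) = j" by (simp_all add: iff)
        then show ?thesis using 2 inv_adj by simp
      next
        case 3
        have "adj i (w (Suc j)) < adj i (w j) \<longleftrightarrow> w (Suc j) < w j"
          using 3 by (intro adj_less_iff) auto
        moreover have "adj j (inv w (Suc i)) < adj j (inv w i) \<longleftrightarrow> inv w (Suc i) < inv w i"
          using 3 by (intro adj_less_iff) (auto simp: iff)
        ultimately show ?thesis using inv_adj by auto
      qed
    qed
    have "divided_difference j (\<Sum>i\<in>{1..n}. if inv w (Suc i) < inv w i then of_nat i * sch (adj i \<circ> w) else 0)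
      = (\<Sum>i\<in>{1..n}. if inv w (Suc i) < inv w i \<and> adj i (w (Suc j)) < adj i (w j)
        then of_nat i * sch (adj i \<circ> (w \<circ> adj j)) else 0)"
      unfolding divided_difference_sum
      by (rule sum.cong)
        (auto simp: divided_difference_mult divided_difference_sch[OF fp j] swap_vars_simps comp_assoc)
    also have "\<dots> = (if w (Suc j) < w j then
        \<Sum>i\<in>{1..n}. if inv (w \<circ> adj j) (Suc i) < inv (w \<circ> adj j) i
          then of_nat i * sch (adj i \<circ> (w \<circ> adj j)) else 0 else 0)"
      unfolding eq by auto
    also have "\<dots> = (if w (Suc j) < w j then nabla (sch (w \<circ> adj j)) else 0)"
    proof (cases "w (Suc j) < w j")
      case True
      then have "(w \<circ> adj j) permutes {1..n}"
        using permutes_comp_adj[OF step.prems j] descent_in_range[OF step.prems j] by blast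
      then show ?thesis by (simp only: True if_True step.IH[OF j True])
    qed simp
    also have "\<dots> = divided_difference j (nabla (sch w))"
      using nabla_of_int[of 0]
      by (simp flip: nabla_divided_difference[OF j] add: divided_difference_sch[OF w j])
    finally show "divided_difference j (nabla (sch w)) = divided_difference j
      (\<Sum>i\<in>{1..n}. if inv w (Suc i) < inv w i then of_nat i * sch (adj i \<circ> w) else 0)" ..
  qed
qed

section \<open>Evaluation on the diagonal\<close>

definition eval_ones :: "poly_ring \<Rightarrow> int" where
  "eval_ones = subst_poly (\<lambda>_. 1)"

lemma ring_hom_eval_ones: "ring_hom eval_ones"
  unfolding eval_ones_def by (rule ring_hom_subst_poly)

lemmas eval_ones_simps = ring_hom_simps[OF ring_hom_eval_ones]

lemma eval_ones_X [simp]: "eval_ones (X i) = 1"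
  by (simp add: eval_ones_def)

definition restrict_diagonal :: "poly_ring \<Rightarrow> int poly" where
  "restrict_diagonal = subst_poly (\<lambda>i. if i = 0 then 0 else [:0, 1:])"

lemma ring_hom_restrict_diagonal: "ring_hom restrict_diagonal"
  unfolding restrict_diagonal_def by (rule ring_hom_subst_poly)

lemmas restrict_diagonal_simps = ring_hom_simps[OF ring_hom_restrict_diagonal]

lemma restrict_diagonal_X: "restrict_diagonal (X i) = (if i = 0 then 0 else [:0, 1:])"
  by (simp add: restrict_diagonal_def)

lemma pderiv_restrict_diagonal: "pderiv (restrict_diagonal f) = restrict_diagonal (nabla f)"
  by (induction f rule: poly_ring_induct)
    (auto simp: restrict_diagonal_simps restrict_diagonal_X nabla_X nabla_add nabla_mult
      pderiv_add pderiv_mult pderiv_pCons of_int_poly ring_hom_zero[OF ring_hom_restrict_diagonal])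

lemma poly_restrict_diagonal_1: "poly (restrict_diagonal f) 1 = eval_ones (drop_var0 f)"
  by (rule ring_hom_poly_eqI)
    (auto simp: ring_hom_def restrict_diagonal_simps eval_ones_simps drop_var0_simps
      restrict_diagonal_X drop_var0_X)

lemma coeff_0_restrict_diagonal: "coeff (restrict_diagonal f) 0 = const_term f"
  by (rule ring_hom_poly_eqI)
    (auto simp: ring_hom_def restrict_diagonal_simps const_term_simps restrict_diagonal_X coeff_mult)

lemma poly_1_pos:
  fixes p :: "int poly"
  assumes "\<And>k. 0 \<le> coeff p k" "p \<noteq> 0"
  shows "0 < poly p 1"
proof -
  have "0 < coeff p (degree p)" using assms leading_coeff_0_iff[of p] by (metis order_le_less)
  also have "\<dots> \<le> (\<Sum>i\<le>degree p. coeff p i)"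
    by (rule member_le_sum) (use assms in auto)
  also have "\<dots> = poly p 1" by (simp add: poly_altdef)
  finally show ?thesis .
qed

text \<open>Restricted to the diagonal, \<^term>\<open>nabla\<close> is the derivative of a univariate polynomial, and
  \<open>nabla_sch\<close> expresses it as a positive combination of shorter Schubert polynomials.\<close>

lemma eval_ones_sch_pos:
  assumes "fin_perm w"
  shows "0 < eval_ones (sch w)"
proof -
  \<comment> \<open>Nonnegative coefficients are carried along because the value of a derivative at
    1 alone does not control the value of the polynomial.\<close>
  define R where "R v \<longleftrightarrow> (\<forall>k. 0 \<le> coeff (restrict_diagonal (sch v)) k) \<and>
    0 < poly (restrict_diagonal (sch v)) 1" for v
  \<comment> \<open>\<open>nabla_sch\<close> removes left descents of \<open>v\<close>, which are
    descents of \<open>inv v\<close>; hence the induction runs over the inverse.\<close>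
  have "R (inv u)" if "fin_perm u" for u
    using that
  proof (induction rule: fin_perm_descent_induct)
    case (step u)
    define v where "v = inv u"
    have v: "fin_perm v" and inv_v: "inv v = u"
      using fin_perm_inv[OF step.hyps] by (auto simp: v_def)
    have IH: "R (adj i \<circ> v)" if "1 \<le> i" "u (Suc i) < u i" for i
      unfolding v_def inv_comp_adj[OF step.hyps, symmetric] by (rule step.IH[OF that])
    show "R v"
    proof (cases "v = id")
      case True
      then show ?thesis by (simp add: R_def sch_id restrict_diagonal_simps)
    next
      case False
      obtain n where n: "v permutes {1..n}" using v by (auto simp: fin_perm_def)
      have "u \<noteq> id" using False inv_v fin_perm_inv(4)[OF v] by (metis inv_id)
      then obtain r where r: "1 \<le> r" "u (Suc r) < u r"
        using fin_perm_no_descent[OF step.hyps] fin_perm_ascent_or_descent[OF step.hyps] by blast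
      have "u permutes {1..n}" using permutes_inv[OF n] inv_v by simp
      then have "r < n" using r by (rule descent_in_range)
      let ?h = "restrict_diagonal (sch v)"
      have deriv: "pderiv ?h =
        (\<Sum>i\<in>{1..n}. if u (Suc i) < u i then of_nat i * restrict_diagonal (sch (adj i \<circ> v)) else 0)"
        unfolding pderiv_restrict_diagonal nabla_sch[OF v n] inv_v restrict_diagonal_simps
        by (rule sum.cong) (auto simp: restrict_diagonal_simps)
      have "0 \<le> coeff (pderiv ?h) k" for k
        unfolding deriv coeff_sum
        by (rule sum_nonneg) (use IH in \<open>auto simp: R_def of_nat_poly\<close>)
      \<comment> \<open>Integration: coefficient \<open>k\<close> of the derivative is
        \<open>Suc k\<close> times this one.\<close>
      then have "0 \<le> coeff ?h (Suc k)" for k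
        by (metis coeff_pderiv of_nat_0_less_iff zero_le_mult_iff zero_less_Suc not_less)
      moreover have "0 \<le> coeff ?h 0"
        using False by (simp add: coeff_0_restrict_diagonal const_term_sch[OF v])
      ultimately have nonneg: "0 \<le> coeff ?h k" for k by (cases k) auto
      have "poly (pderiv ?h) 1 = 
        (\<Sum>i\<in>{1..n}. if u (Suc i) < u i then int i * poly (restrict_diagonal (sch (adj i \<circ> v))) 1 else 0)"
        unfolding deriv poly_sum by (rule sum.cong) auto
      also have "\<dots> > 0"
        by (rule sum_pos2[of _ r]) (use r \<open>r < n\<close> IH in \<open>auto simp: R_def less_imp_le\<close>)
      finally have "?h \<noteq> 0" by auto
      then show ?thesis using nonneg poly_1_pos by (simp add: R_def)
    qed
  qed
  from this[of "inv w"] have "R w" using fin_perm_inv[OF assms] by simp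
  then show ?thesis
    by (simp add: R_def poly_restrict_diagonal_1 drop_var0_sch[OF assms])
qed

subsection \<open>Inversion of variables\<close>

definition to_laurent :: "poly_ring \<Rightarrow> laurent_ring" where
  "to_laurent = subst_poly LX"

definition to_laurent_inv :: "poly_ring \<Rightarrow> laurent_ring" where
  "to_laurent_inv = subst_poly LX_inv"

definition staircase :: "nat \<Rightarrow> laurent_ring" where
  "staircase n = (\<Prod>i\<in>{1..n}. LX i ^ (n - i))"

definition laurent_inv :: "laurent_ring \<Rightarrow> laurent_ring" where
  "laurent_inv = lin_ext (\<lambda>e. Poly_Mapping.single (- e) 1)"

text \<open>\<open>map_key\<close> precomposes an exponent vector with \<open>adj i\<close>; since
  \<open>adj i\<close> is an involution, this is the same as moving exponents forward.\<close>

definition laurent_swap :: "nat \<Rightarrow> laurent_ring \<Rightarrow> laurent_ring" where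
  "laurent_swap i = lin_ext (\<lambda>e. Poly_Mapping.single (Poly_Mapping.map_key (adj i) e) 1)"

definition laurent_eval_ones :: "laurent_ring \<Rightarrow> int" where
  "laurent_eval_ones = lin_ext (\<lambda>_. 1)"

lemma laurent_ring_homs:
  "ring_hom to_laurent" "ring_hom to_laurent_inv" "ring_hom laurent_inv"
  "ring_hom (laurent_swap i)" "ring_hom laurent_eval_ones"
  unfolding to_laurent_def to_laurent_inv_def laurent_inv_def laurent_swap_def laurent_eval_ones_def
  by (simp_all add: ring_hom_subst_poly ring_hom_lin_ext mult_single map_key_plus)

lemmas to_laurent_simps = ring_hom_simps[OF laurent_ring_homs(1)]
lemmas to_laurent_inv_simps = ring_hom_simps[OF laurent_ring_homs(2)]
lemmas laurent_inv_simps = ring_hom_simps[OF laurent_ring_homs(3)]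
lemmas laurent_swap_simps = ring_hom_simps[OF laurent_ring_homs(4)]
lemmas laurent_eval_ones_simps = ring_hom_simps[OF laurent_ring_homs(5)]

lemma to_laurent_X [simp]: "to_laurent (X i) = LX i" "to_laurent_inv (X i) = LX_inv i"
  by (simp_all add: to_laurent_def to_laurent_inv_def)

lemma laurent_inv_LX [simp]: "laurent_inv (LX i) = LX_inv i" "laurent_inv (LX_inv i) = LX i"
  by (simp_all add: laurent_inv_def LX_def LX_inv_def flip: single_uminus)

lemma laurent_swap_single:
  "laurent_swap i (Poly_Mapping.single (Poly_Mapping.single j c) 1)
    = Poly_Mapping.single (Poly_Mapping.single (adj i j) c) 1"
  using map_key_single[of "adj i" "adj i j" c] by (simp add: laurent_swap_def)

lemma laurent_swap_LX [simp]: "laurent_swap i (LX j) = LX (adj i j)"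
  "laurent_swap i (LX_inv j) = LX_inv (adj i j)"
  by (simp_all add: LX_def LX_inv_def laurent_swap_single)

lemma laurent_eval_ones_LX [simp]: "laurent_eval_ones (LX i) = 1" "laurent_eval_ones (LX_inv i) = 1"
  by (simp_all add: LX_def LX_inv_def laurent_eval_ones_def)

lemma laurent_inv_to_laurent: "laurent_inv (to_laurent f) = to_laurent_inv f"
  "laurent_inv (to_laurent_inv f) = to_laurent f"
  by (rule ring_hom_poly_eqI[OF ring_hom_comp[OF laurent_ring_homs(3) laurent_ring_homs(1)] laurent_ring_homs(2)], simp)
    (rule ring_hom_poly_eqI[OF ring_hom_comp[OF laurent_ring_homs(3) laurent_ring_homs(2)] laurent_ring_homs(1)], simp)

lemma laurent_swap_to_laurent: "laurent_swap i (to_laurent f) = to_laurent (swap_vars i f)"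
  "laurent_swap i (to_laurent_inv f) = to_laurent_inv (swap_vars i f)"
  by (rule ring_hom_poly_eqI[OF ring_hom_comp[OF laurent_ring_homs(4) laurent_ring_homs(1)]
        ring_hom_comp[OF laurent_ring_homs(1) ring_hom_swap_vars]], simp)
    (rule ring_hom_poly_eqI[OF ring_hom_comp[OF laurent_ring_homs(4) laurent_ring_homs(2)]
        ring_hom_comp[OF laurent_ring_homs(2) ring_hom_swap_vars]], simp)

lemma laurent_eval_ones_to_laurent: "laurent_eval_ones (to_laurent f) = eval_ones f"
  "laurent_eval_ones (to_laurent_inv f) = eval_ones f"
  by (rule ring_hom_poly_eqI[OF ring_hom_comp[OF laurent_ring_homs(5) laurent_ring_homs(1)] ring_hom_eval_ones], simp)
    (rule ring_hom_poly_eqI[OF ring_hom_comp[OF laurent_ring_homs(5) laurent_ring_homs(2)] ring_hom_eval_ones], simp)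

lemma laurent_eval_ones_staircase: "laurent_eval_ones (staircase n) = 1"
  by (simp add: staircase_def laurent_eval_ones_simps)

lemma to_laurent_inj: "to_laurent f = to_laurent g \<longleftrightarrow> f = g"
proof -
  \<comment> \<open>The embedding \<kappa> of exponents is injective, so the coefficient of
    \<open>f\<close> at \<open>e\<close> can be read off the image at
    \<open>\<kappa> e\<close>.\<close>
  define \<kappa> :: "(nat \<Rightarrow>\<^sub>0 nat) \<Rightarrow> (nat \<Rightarrow>\<^sub>0 int)" where
    "\<kappa> e = (\<Sum>i\<in>Poly_Mapping.keys e. Poly_Mapping.single i (int (Poly_Mapping.lookup e i)))" for e
  have "Poly_Mapping.lookup (\<kappa> e) i = int (Poly_Mapping.lookup e i)" for e i
    by (simp add: \<kappa>_def lookup_sum lookup_single when_def in_keys_iff)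
  then have \<kappa>_inj: "\<kappa> e = \<kappa> e' \<longleftrightarrow> e = e'" for e e'
    by (metis of_nat_eq_iff poly_mapping_eqI)
  have pow: "LX i ^ k = Poly_Mapping.single (Poly_Mapping.single i (int k)) 1" for i k
    by (induction k) (auto simp: LX_def mult_single add.commute simp flip: single_add)
  have prod: "(\<Prod>i\<in>A. Poly_Mapping.single (h i) 1) = Poly_Mapping.single (\<Sum>i\<in>A. h i) (1::int)"
    for h :: "nat \<Rightarrow> nat \<Rightarrow>\<^sub>0 int" and A
    by (induction A rule: infinite_finite_induct) (auto simp: mult_single)
  have of_int_mult: "of_int c * Poly_Mapping.single e (1::int) = Poly_Mapping.single e c"
    for c and e :: "nat \<Rightarrow>\<^sub>0 int"
    by (simp flip: single_of_int add: mult_single)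
  have eq: "to_laurent f = (\<Sum>e\<in>Poly_Mapping.keys f. Poly_Mapping.single (\<kappa> e) (Poly_Mapping.lookup f e))" for f
    unfolding to_laurent_def subst_poly_def pow prod \<kappa>_def[symmetric] of_int_mult ..
  have "Poly_Mapping.lookup (to_laurent f) (\<kappa> e) = Poly_Mapping.lookup f e" for f e
    unfolding eq by (simp add: lookup_sum lookup_single when_def \<kappa>_inj in_keys_iff)
  then show ?thesis by (metis poly_mapping_eqI)
qed

lemma to_laurent_inv_inj: "to_laurent_inv f = to_laurent_inv g \<longleftrightarrow> f = g"
  by (metis laurent_inv_to_laurent(2) to_laurent_inj)

lemma LX_inv_mult_LX: "LX_inv i * LX i = 1"
  using LX_mult_LX_inv[of i] by (simp add: mult.commute)

lemma staircase_inverse: "staircase n * laurent_inv (staircase n) = 1"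
  by (simp add: staircase_def laurent_inv_simps LX_mult_LX_inv flip: prod.distrib power_mult_distrib)

text \<open>The exponents at \<open>i\<close> and \<open>Suc i\<close> differ by one, so the swap
  multiplies the staircase by \<open>LX (Suc i) / LX i\<close>; the division is cleared. The bound
  \<open>i < n\<close> makes \<open>n - i\<close> the successor of \<open>n - Suc i\<close>.\<close>

lemma laurent_swap_staircase:
  assumes "1 \<le> i" "i < n"
  shows "laurent_swap i (staircase n) * LX i = staircase n * LX (Suc i)"
proof -
  have "adj i permutes {1..n}" using assms by (auto intro: permutes_swap_id)
  then have bij: "bij_betw (adj i) {1..n} {1..n}" by (rule permutes_imp_bij)
  have "laurent_swap i (staircase n) = (\<Prod>j\<in>{1..n}. LX (adj i j) ^ (n - j))"
    by (simp add: staircase_def laurent_swap_simps)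
  also have "\<dots> = (\<Prod>j\<in>{1..n}. LX (adj i (adj i j)) ^ (n - adj i j))"
    by (rule prod.reindex_bij_betw[OF bij, symmetric])
  finally have "laurent_swap i (staircase n) * LX i
      = (\<Prod>j\<in>{1..n}. LX j ^ (n - adj i j) * (if j = i then LX j else 1))"
    using assms by (simp add: prod.distrib)
  also have "\<dots> = (\<Prod>j\<in>{1..n}. LX j ^ (n - j) * (if j = Suc i then LX j else 1))"
  proof (rule prod.cong)
    fix j
    have "n - i = Suc (n - Suc i)" using assms by simp
    then show "LX j ^ (n - adj i j) * (if j = i then LX j else 1)
      = LX j ^ (n - j) * (if j = Suc i then LX j else 1)"
      by (auto simp: transpose_def)
  qed simp
  also have "\<dots> = staircase n * LX (Suc i)"
    using assms by (simp add: staircase_def prod.distrib)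
  finally show ?thesis .
qed

text \<open>A relation and not a function, because the Laurent polynomial on the right need not be a
  polynomial.\<close>

definition staircase_dual :: "nat \<Rightarrow> poly_ring \<Rightarrow> poly_ring \<Rightarrow> bool" where
  "staircase_dual n f g \<longleftrightarrow> to_laurent g = staircase n * to_laurent_inv f"

lemma staircase_dual_sym:
  assumes "staircase_dual n f g"
  shows "staircase_dual n g f"
proof -
  have "to_laurent_inv g = laurent_inv (staircase n) * to_laurent f"
    using arg_cong[of _ _ laurent_inv, OF assms[unfolded staircase_dual_def]]
    by (simp add: laurent_inv_simps laurent_inv_to_laurent)
  then have "staircase n * to_laurent_inv g = (staircase n * laurent_inv (staircase n)) * to_laurent f"
    by (simp add: mult.assoc)
  then show ?thesis by (simp add: staircase_dual_def staircase_inverse)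
qed

lemma staircase_dual_swap_vars:
  assumes "staircase_dual n f g" "1 \<le> i" "i < n"
  shows "LX i * to_laurent (swap_vars i g) = LX (Suc i) * staircase n * to_laurent_inv (swap_vars i f)"
proof -
  have "to_laurent (swap_vars i g) = laurent_swap i (staircase n) * to_laurent_inv (swap_vars i f)"
    using arg_cong[of _ _ "laurent_swap i", OF assms(1)[unfolded staircase_dual_def]]
    by (simp add: laurent_swap_simps laurent_swap_to_laurent)
  then have "LX i * to_laurent (swap_vars i g)
      = (laurent_swap i (staircase n) * LX i) * to_laurent_inv (swap_vars i f)"
    by (simp only: mult_ac)
  then show ?thesis
    unfolding laurent_swap_staircase[OF assms(2,3)] by (simp only: mult_ac)
qed

text \<open>By \<open>laurent_swap_staircase\<close>, symmetry of \<open>f\<close> becomes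
  \<open>X i * swap_vars i g = X (Suc i) * g\<close>; subtracting both sides from
  \<open>X i * g\<close> brings in the divided difference.\<close>

lemma staircase_dual_symmetric_iff:
  assumes dual: "staircase_dual n f g" and i: "1 \<le> i" "i < n"
  shows "swap_vars i f = f \<longleftrightarrow> g = X i * divided_difference i g"
proof -
  have "swap_vars i f = f \<longleftrightarrow> LX (Suc i) * staircase n * to_laurent_inv (swap_vars i f)
    = LX (Suc i) * staircase n * to_laurent_inv f"
  proof
    assume eq: "LX (Suc i) * staircase n * to_laurent_inv (swap_vars i f)
      = LX (Suc i) * staircase n * to_laurent_inv f"
    have "laurent_inv (staircase n) * LX_inv (Suc i) * (LX (Suc i) * staircase n * h) = h" for h
    proof -
      have "laurent_inv (staircase n) * LX_inv (Suc i) * (LX (Suc i) * staircase n * h)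
        = (staircase n * laurent_inv (staircase n)) * (LX_inv (Suc i) * LX (Suc i)) * h"
        by (simp only: mult_ac)
      then show ?thesis by (simp add: staircase_inverse LX_inv_mult_LX)
    qed
    then show "swap_vars i f = f" by (metis eq to_laurent_inv_inj)
  qed simp
  also have "\<dots> \<longleftrightarrow> to_laurent (X i * swap_vars i g) = to_laurent (X (Suc i) * g)"
    using staircase_dual_swap_vars[OF dual i] dual
    by (simp add: to_laurent_simps staircase_dual_def mult.assoc)
  also have "\<dots> \<longleftrightarrow> X i * swap_vars i g = X (Suc i) * g"
    by (rule to_laurent_inj)
  also have "\<dots> \<longleftrightarrow> X i * (g - swap_vars i g) = g * (X i - X (Suc i))"
    by (auto simp: algebra_simps)
  also have "\<dots> \<longleftrightarrow> (X i * divided_difference i g) * (X i - X (Suc i)) = g * (X i - X (Suc i))"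
    by (simp only: divided_difference_eq[symmetric] mult.assoc)
  also have "\<dots> \<longleftrightarrow> g = X i * divided_difference i g"
    using mult_right_cancel[OF X_diff_neq_0[of i "Suc i"]] by auto
  finally show ?thesis .
qed

lemma staircase_dual_divided_difference:
  assumes dual: "staircase_dual n f g" and i: "1 \<le> i" "i < n"
  shows "to_laurent (X i * divided_difference i g)
    = staircase n * to_laurent_inv (f - X i * divided_difference i f)"
proof -
  let ?a = "LX i" and ?b = "LX (Suc i)" and ?J = to_laurent_inv and ?L = to_laurent
  have nz: "?a - ?b \<noteq> 0"
    using to_laurent_inj[of "X i" "X (Suc i)"] X_neq[of i "Suc i"] by simp
  have "?L (X i * divided_difference i g) * (?a - ?b) = ?L (X i * (g - swap_vars i g))"
    unfolding divided_difference_eq[symmetric] by (simp add: to_laurent_simps mult.assoc)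
  also have "\<dots> = staircase n * (?a * ?J f - ?b * ?J (swap_vars i f))"
    using staircase_dual_swap_vars[OF dual i] dual
    by (simp add: to_laurent_simps staircase_dual_def algebra_simps)
  finally have L: "?L (X i * divided_difference i g) * (?a - ?b)
    = staircase n * (?a * ?J f - ?b * ?J (swap_vars i f))" .
  have J: "?J (divided_difference i f) * (LX_inv i - LX_inv (Suc i)) = ?J f - ?J (swap_vars i f)"
    using arg_cong[OF divided_difference_eq[of i f], of ?J] by (simp add: to_laurent_inv_simps)
  \<comment> \<open>Relates the denominator to its image under inversion of the variables; both
    sides equal \<open>1 - LX (Suc i) * LX_inv i\<close>.\<close>
  have "(?a - ?b) * LX_inv i = - ?b * (LX_inv i - LX_inv (Suc i))"
    by (simp add: algebra_simps LX_mult_LX_inv LX_inv_mult_LX)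
  then have "?J (divided_difference i f) * ((?a - ?b) * LX_inv i)
    = ?J (divided_difference i f) * (- ?b * (LX_inv i - LX_inv (Suc i)))"
    by (simp only:)
  then have "?J (X i * divided_difference i f) * (?a - ?b)
    = - ?b * (?J (divided_difference i f) * (LX_inv i - LX_inv (Suc i)))"
    by (simp only: to_laurent_inv_simps to_laurent_X mult_ac)
  then have *: "?J (X i * divided_difference i f) * (?a - ?b) = - ?b * (?J f - ?J (swap_vars i f))"
    by (simp only: J)
  have "staircase n * ?J (f - X i * divided_difference i f) * (?a - ?b)
    = staircase n * (?J f * (?a - ?b) - ?J (X i * divided_difference i f) * (?a - ?b))"
    by (simp only: ring_hom_diff[OF laurent_ring_homs(2)] left_diff_distrib mult.assoc)
  also have "\<dots> = staircase n * (?a * ?J f - ?b * ?J (swap_vars i f))"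
    unfolding * by (simp add: algebra_simps)
  finally have "staircase n * ?J (f - X i * divided_difference i f) * (?a - ?b)
    = staircase n * (?a * ?J f - ?b * ?J (swap_vars i f))" .
  then have "?L (X i * divided_difference i g) * (?a - ?b)
    = staircase n * ?J (f - X i * divided_difference i f) * (?a - ?b)"
    by (simp only: L)
  then show ?thesis by (rule mult_right_cancel[OF nz, THEN iffD1])
qed

lemma staircase_dual_eval_ones:
  assumes "staircase_dual n f g" "1 \<le> i" "i < n"
  shows "eval_ones (divided_difference i g) = eval_ones (f - X i * divided_difference i f)"
  using arg_cong[OF staircase_dual_divided_difference[OF assms], of laurent_eval_ones]
  by (simp add: laurent_eval_ones_simps laurent_eval_ones_to_laurent laurent_eval_ones_staircase
      eval_ones_simps)

subsection \<open>Pattern avoidance\<close>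

lemma staircase_dual_ascent_iff:
  assumes dual: "staircase_dual n (sch w) (sch u)" and w: "fin_perm w" and u: "fin_perm u"
    and i: "1 \<le> i" "i < n"
  shows "w i < w (Suc i) \<longleftrightarrow> good_descent u i"
proof -
  have "w i < w (Suc i) \<longleftrightarrow> divided_difference i (sch w) = 0"
    using fin_perm_ascent_or_descent[OF w] sch_nonzero[OF fin_perm_comp_transpose[OF w, of i "Suc i"]] i
    by (auto simp: divided_difference_sch[OF w i(1)])
  also have "\<dots> \<longleftrightarrow> sch u = X i * divided_difference i (sch u)"
    using staircase_dual_symmetric_iff[OF dual i] by (simp add: divided_difference_eq_0_iff)
  also have "\<dots> \<longleftrightarrow> good_descent u i"
  proof (cases "u (Suc i) < u i")
    case True
    then show ?thesis
      using good_descent_iff[OF u i(1) True] by (simp add: divided_difference_sch[OF u i(1)])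
  next
    \<comment> \<open>Without a descent of \<open>u\<close> the divided difference is 0 while
      \<open>sch u\<close> is not, so both sides fail.\<close>
    case False
    then show ?thesis
      using sch_nonzero[OF u] by (simp add: divided_difference_sch[OF u i(1)] good_descent_def)
  qed
  finally show ?thesis .
qed

text \<open>If no entry before position \<open>i\<close> is below \<open>w (i + 1)\<close>, Monk's rule makes
  \<open>sch w - X i * sch (w \<circ> adj i)\<close> a negative combination of Schubert polynomials, whereas its
  staircase dual is \<open>X i * sch (u \<circ> adj i)\<close>, which is positive at the all-ones point.\<close>

lemma staircase_dual_common_descent:
  assumes dual: "staircase_dual n (sch w) (sch u)" and w: "fin_perm w" and u: "fin_perm u"
    and i: "1 \<le> i" "i < n" and desc: "w (Suc i) < w i" "u (Suc i) < u i"
  shows "\<exists>j. 1 \<le> j \<and> j < i \<and> w j < w (Suc i)"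
proof (rule ccontr)
  assume none: "\<not> ?thesis"
  let ?v = "w \<circ> adj i"
  have v: "fin_perm ?v" using w i by (intro fin_perm_comp_transpose) auto
  obtain m where m: "w permutes {1..m}" "Suc i \<le> m" and
    monk: "X i * sch ?v = sch w + (\<Sum>b\<in>{1..Suc m} - {Suc i}. monk_term i ?v b)"
    by (rule monk_rule_descent[OF w i(1) desc(1)])
  have "0 \<le> eval_ones (monk_term i ?v b)" if b: "b \<in> {1..Suc m} - {Suc i}" for b
  proof -
    have "\<not> bruhat_cover ?v b i"
    proof
      assume "bruhat_cover ?v b i"
      then have "b < i" "w b < w (Suc i)" by (auto simp: bruhat_cover_def transpose_def)
      then show False using none b by auto
    qed
    moreover have "0 < eval_ones (sch (?v \<circ> transpose i b))"
      by (rule eval_ones_sch_pos, rule fin_perm_comp_transpose[OF v]) (use i b in auto)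
    ultimately show ?thesis by (simp add: monk_term_def eval_ones_simps)
  qed
  then have "0 \<le> eval_ones (\<Sum>b\<in>{1..Suc m} - {Suc i}. monk_term i ?v b)"
    unfolding eval_ones_simps by (rule sum_nonneg)
  then have "eval_ones (sch w - X i * sch ?v) \<le> 0"
    by (simp add: monk eval_ones_simps)
  moreover have "0 < eval_ones (sch (u \<circ> adj i))"
    using u i by (intro eval_ones_sch_pos fin_perm_comp_transpose) auto
  ultimately show False
    using staircase_dual_eval_ones[OF dual i] desc
    by (simp add: divided_difference_sch[OF w i(1)] divided_difference_sch[OF u i(1)])
qed

lemma staircase_dual_good:
  assumes dual: "staircase_dual n (sch w) (sch u)" and w: "fin_perm w" and u: "fin_perm u"
    and "1 \<le> i" "i < n"
  shows "w i < w (Suc i) \<or> good_descent w i"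
  using assms(4,5)
proof (induction i rule: less_induct)
  case (less i)
  note dual' = staircase_dual_sym[OF dual]
  show ?case
  proof (rule ccontr)
    assume bad: "\<not> ?thesis"
    then have w_desc: "w (Suc i) < w i" using fin_perm_ascent_or_descent[OF w] by blast
    have "\<not> u i < u (Suc i)"
      using bad staircase_dual_ascent_iff[OF dual' u w less.prems] by blast
    then have u_desc: "u (Suc i) < u i" by (rule fin_perm_ascent_or_descent[OF u])
    obtain j where j: "1 \<le> j" "j < i" "w j < w (Suc i)"
      using staircase_dual_common_descent[OF dual w u less.prems w_desc u_desc] by blast
    obtain j' where j': "1 \<le> j'" "j' < i" "u j' < u (Suc i)"
      using staircase_dual_common_descent[OF dual' u w less.prems u_desc w_desc] by blast
    \<comment> \<open>A good descent at \<open>c\<close> puts entry \<open>i\<close>, and with the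
      descent at \<open>i\<close> also entry \<open>Suc i\<close>, below all earlier entries. This
      contradicts \<open>j\<close> if it occurs in \<open>w\<close>, and \<open>j'\<close> if it
      occurs in \<open>u\<close>.\<close>
    define c where "c = i - 1"
    have c: "1 \<le> c" "c < i" "Suc c = i" using j by (auto simp: c_def)
    have "\<not> good_descent w c"
    proof
      assume good: "good_descent w c"
      then have "w i < w j" if "j < c"
        using that j c unfolding good_descent_def by auto
      moreover have "w i < w c" using good c by (simp add: good_descent_def)
      moreover have "j < c \<or> j = c" using j c by linarith
      ultimately show False using j w_desc by auto
    qed
    then have "w c < w (Suc c)" using less.IH[of c] c less.prems by simp
    then have good: "good_descent u c"
      using staircase_dual_ascent_iff[OF dual w u, of c] c less.prems by simp
    have "u i < u j'" if "j' < c"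
      using good that j' c unfolding good_descent_def by auto
    moreover have "u i < u c" using good c by (simp add: good_descent_def)
    moreover have "j' < c \<or> j' = c" using j' c by linarith
    ultimately show False using j' u_desc by auto
  qed
qed

text \<open>A discrete intermediate value argument: the last position before \<open>b\<close> whose
  entry exceeds the level \<open>w k\<close>.\<close>

lemma last_above:
  fixes w :: "nat \<Rightarrow> nat"
  assumes "w k < w a" "a < b" "w b \<le> w k"
  obtains p where "a \<le> p" "p < b" "w k < w p" "w (Suc p) \<le> w k"
proof -
  define p where "p = (GREATEST p. a \<le> p \<and> p < b \<and> w k < w p)"
  have p: "a \<le> p \<and> p < b \<and> w k < w p"
    unfolding p_def by (rule GreatestI_nat[of _ a b]) (use assms in auto)
  have "w (Suc p) \<le> w k"
  proof (rule ccontr)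
    assume above: "\<not> w (Suc p) \<le> w k"
    then have "Suc p \<noteq> b" using assms(3) by auto
    then have "Suc p \<le> p"
      unfolding p_def[symmetric] by (subst (2) p_def, intro Greatest_le_nat[of _ _ b]) (use p above in auto)
    then show False by simp
  qed
  then show ?thesis using that p by blast
qed

text \<open>In either pattern the sequence falls from above the level \<open>w k\<close> to at most
  \<open>w k\<close> before or at position \<open>k\<close>. The fall is a good descent, so
  \<open>w k\<close> cannot occur later strictly between its two entries.\<close>

lemma avoids_if_good:
  assumes w: "fin_perm w" and good: "\<And>i. 1 \<le> i \<Longrightarrow> i < n \<Longrightarrow> w i < w (Suc i) \<or> good_descent w i"
  shows "avoids_132 n w" "avoids_312 n w"
proof -
  show "avoids_132 n w"
    unfolding avoids_132_def
  proof safe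
    fix i j k assume ijk: "1 \<le> i" "i < j" "j < k" "k \<le> n" "w i < w k" "w k < w j"
    obtain p where p: "j \<le> p" "p < k" "w k < w p" "w (Suc p) \<le> w k"
      by (rule last_above[of w k j k]) (use ijk in auto)
    then have good_p: "good_descent w p" using good[of p] ijk by auto
    show False
    proof (cases "Suc p = k")
      \<comment> \<open>The fall ends at \<open>k\<close> itself: then \<open>w k\<close> lies below
        all entries before \<open>p\<close>, contradicting \<open>w i < w k\<close>.\<close>
      case True
      then show False using good_p ijk p unfolding good_descent_def
        by (metis less_asym less_le_trans)
    next
      case False
      then have "w (Suc p) < w k" using p fin_perm_inj[OF w, of "Suc p" k] by simp
      then show False using good_p p False unfolding good_descent_def
        by (metis Suc_lessI)
    qed
  qed
  show "avoids_312 n w"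
    unfolding avoids_312_def
  proof safe
    fix i j k assume ijk: "1 \<le> i" "i < j" "j < k" "k \<le> n" "w j < w k" "w k < w i"
    obtain p where p: "i \<le> p" "p < j" "w k < w p" "w (Suc p) \<le> w k"
      by (rule last_above[of w k i j]) (use ijk in auto)
    then have "good_descent w p" using good[of p] ijk by auto
    moreover have "w (Suc p) < w k" using p ijk fin_perm_inj[OF w, of "Suc p" k] by simp
    ultimately show False using p ijk unfolding good_descent_def by auto
  qed
qed

text \<open>Reversing values turns 312 into 132, so both permutations avoid 132. It also exchanges
  smaller and larger later entries, of which position \<open>i\<close> has \<open>n - i\<close> in
  total.\<close>

lemma staircase_dual_if_avoids:
  assumes w: "w permutes {1..n}" and avoids: "avoids_132 n w" "avoids_312 n w"
  shows "(longest_perm n \<circ> w) permutes {1..n}"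
    and "staircase_dual n (schubert n w) (schubert n (longest_perm n \<circ> w))"
proof -
  let ?u = "longest_perm n \<circ> w"
  show u: "?u permutes {1..n}"
    using w longest_perm_permutes by (rule permutes_compose)
  have less: "?u i < ?u j \<longleftrightarrow> w j < w i" if "i \<in> {1..n}" "j \<in> {1..n}" for i j
    using permutes_in_image[OF w, of i] permutes_in_image[OF w, of j] that
    by (auto simp: longest_perm_def)
  have "avoids_132 n ?u"
    unfolding avoids_132_def
  proof safe
    fix i j k assume ijk: "1 \<le> i" "i < j" "j < k" "k \<le> n" "?u i < ?u k" "?u k < ?u j"
    then have "w k < w i" "w j < w k" using less[of i k] less[of k j] by auto
    then show False using avoids(2) ijk unfolding avoids_312_def by blast
  qed
  then have su: "schubert n ?u = (\<Prod>i\<in>{1..n}. X i ^ lehmer n ?u i)"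
    by (rule schubert_avoids_132[OF u])
  have sw: "schubert n w = (\<Prod>i\<in>{1..n}. X i ^ lehmer n w i)"
    by (rule schubert_avoids_132[OF w avoids(1)])
  have code: "lehmer n ?u i + lehmer n w i = n - i" if i: "i \<in> {1..n}" for i
  proof -
    let ?B = "{j. i < j \<and> j \<le> n \<and> w i < w j}" and ?C = "{j. i < j \<and> j \<le> n \<and> w j < w i}"
    have "{j. i < j \<and> j \<le> n \<and> ?u j < ?u i} = ?B"
      using i less by auto
    then have "lehmer n ?u i = card ?B"
      by (simp only: lehmer_def)
    moreover have "card (?B \<union> ?C) = card ?B + card ?C"
      by (rule card_Un_disjoint) auto
    moreover have "w j < w i \<longleftrightarrow> \<not> w i < w j" if "i < j" for j
      using that inj_eq[OF permutes_inj[OF w], of i j] by auto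
    then have "?B \<union> ?C = {i<..n}" by auto
    ultimately show ?thesis by (simp add: lehmer_def)
  qed
  have "LX i ^ (n - i) * LX_inv i ^ lehmer n w i = LX i ^ lehmer n ?u i" if "i \<in> {1..n}" for i
  proof -
    have "LX i ^ (n - i) * LX_inv i ^ lehmer n w i
      = LX i ^ lehmer n ?u i * (LX i * LX_inv i) ^ lehmer n w i"
      unfolding code[OF that, symmetric] by (simp only: power_add power_mult_distrib mult.assoc)
    then show ?thesis by (simp add: LX_mult_LX_inv)
  qed
  then show "staircase_dual n (schubert n w) (schubert n ?u)"
    unfolding staircase_dual_def su sw
    by (simp add: staircase_def to_laurent_simps to_laurent_inv_simps flip: prod.distrib)
qed

theorem theorem1p1:
  fixes n :: nat and w :: "nat \<Rightarrow> nat"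
  assumes "n \<ge> 1" and "w permutes {1..n}"
  shows "is_schubert_polynomial ((\<Prod>i\<in>{1..n}. LX i ^ (n - i)) * subst_poly LX_inv (schubert n w))
    \<longleftrightarrow> avoids_132 n w \<and> avoids_312 n w"
proof -
  have dual_iff: "(\<Prod>i\<in>{1..n}. LX i ^ (n - i)) * subst_poly LX_inv (schubert n w) = subst_poly LX f
    \<longleftrightarrow> staircase_dual n (schubert n w) f" for f
    by (auto simp: staircase_dual_def staircase_def to_laurent_def to_laurent_inv_def)
  show ?thesis
  proof
    assume "is_schubert_polynomial ((\<Prod>i\<in>{1..n}. LX i ^ (n - i)) * subst_poly LX_inv (schubert n w))"
    then obtain m u where u: "u permutes {1..m}"
      and dual: "staircase_dual n (schubert n w) (schubert m u)"
      unfolding is_schubert_polynomial_def dual_iff by blast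
    \<comment> \<open>\<open>m\<close> is unrelated to \<open>n\<close>; passing to
      \<open>sch\<close> puts both partners on the same footing.\<close>
    have "fin_perm w" "fin_perm u" using u assms(2) by blast+
    moreover have "staircase_dual n (sch w) (sch u)"
      using dual by (simp add: sch_eq[OF u] sch_eq[OF assms(2)])
    ultimately show "avoids_132 n w \<and> avoids_312 n w"
      using avoids_if_good staircase_dual_good by blast
  next
    assume "avoids_132 n w \<and> avoids_312 n w"
    then show "is_schubert_polynomial ((\<Prod>i\<in>{1..n}. LX i ^ (n - i)) * subst_poly LX_inv (schubert n w))"
      unfolding is_schubert_polynomial_def dual_iff
      using staircase_dual_if_avoids[OF assms(2)] by blast
  qed
qed

end
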